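(* Let $X$ be a dendrite and $(\mathcal{E},\mathcal{F})$ a local resistance form on $X$ such that $(X,d_R)$ is compact, let $m$ be a finite energy dominant measure for $(\mathcal{E},\mathcal{F})$, and assume there exists a coordinate sequence for $(\mathcal{E},\mathcal{F})$ with respect to $m$. Then $d_{\Gamma,m}$ is a shortest path metric on $X$.
   Context: A dendrite is an arcwise connected topological space containing no subset homeomorphic to a circle; for $x,y$ in a dendrite there is a unique (up to reparametrization) path $\gamma_{x,y}:[0,1]\to X$ from $x$ to $y$. A metric $d$ on a dendrite is a shortest path metric if $d(x,y)=d(x,z)+d(z,y)$ for all $x,y$ and all $z\in\gamma_{x,y}([0,1])$. Resistance form $(\mathcal{E},\mathcal{F})$ on $X$: (RF1) $\mathcal{E}$ nonnegative definite symmetric bilinear on a vector space $\mathcal{F}$ of real functions, $\mathcal{E}(u)=0$ iff $u$ constant; (RF2) $(\mathcal{F}/\text{constants},\mathcal{E})$ Hilbert; (RF3) $\mathcal{F}$ separates points; (RF4) $d_R(x,y):=\sup\{|u(x)-u(y)|^2:\mathcal{E}(u)\le1\}<\infty$; (RF5) Markov property. Local means strongly local in the Dirichlet form sense. Energy measure: $\int\varphi\,d\Gamma(f)=\mathcal{E}(\varphi f,f)-\frac12\mathcal{E}(\varphi,f^2)$. Energy dominant $m$: full-support Borel measure with $\Gamma(f)\ll m$ for all $f\in\mathcal{F}$; $\Gamma(f)\le m$ means $d\Gamma(f)/dm\le1$ a.e. Coordinate sequence w.r.t. $m$: $(f_n)\subset\mathcal{F}$ with $\mathcal{E}_1$-dense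 span and $\Gamma(f_n)\le m$. $d_{\Gamma,m}(x,y)=\sup\{f(x)-f(y):f\in\mathcal{F},\ \Gamma(f)\le m\}$. *)

theory Defs
  imports "HOL-Analysis.Analysis" "HOL-Probability.Probability"
begin

text \<open>Throughout, the space X is the whole universe of the type 'a, so real functions
  on X are functions of type 'a => real.\<close>

definition resistance_form ::
  "(('a \<Rightarrow> real) \<Rightarrow> ('a \<Rightarrow> real) \<Rightarrow> real) \<Rightarrow> ('a \<Rightarrow> real) set \<Rightarrow> bool" where
  "resistance_form E F \<longleftrightarrow>
     \<comment> \<open>RF1: F vector space containing constants; E symmetric bilinear nonneg.; kernel = constants\<close>
     (\<forall>c. (\<lambda>_. c) \<in> F) \<and>
     (\<forall>u\<in>F. \<forall>v\<in>F. (\<lambda>x. u x + v x) \<in> F) \<and>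
     (\<forall>u\<in>F. \<forall>a. (\<lambda>x. a * u x) \<in> F) \<and>
     (\<forall>u\<in>F. \<forall>v\<in>F. E u v = E v u) \<and>
     (\<forall>u\<in>F. \<forall>v\<in>F. \<forall>w\<in>F. E (\<lambda>x. u x + v x) w = E u w + E v w) \<and>
     (\<forall>u\<in>F. \<forall>v\<in>F. \<forall>a. E (\<lambda>x. a * u x) v = a * E u v) \<and>
     (\<forall>u\<in>F. 0 \<le> E u u) \<and>
     (\<forall>u\<in>F. E u u = 0 \<longleftrightarrow> (\<exists>c. u = (\<lambda>_. c))) \<and>
     \<comment> \<open>RF2: F modulo constants is a Hilbert space w.r.t. E (completeness)\<close>
     (\<forall>s. (\<forall>n. s n \<in> F) \<longrightarrow>
          (\<forall>e>0. \<exists>N. \<forall>n\<ge>N. \<forall>k\<ge>N. E (\<lambda>x. s n x - s k x) (\<lambda>x. s n x - s k x) < e) \<longrightarrow>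
          (\<exists>u\<in>F. (\<lambda>n. E (\<lambda>x. s n x - u x) (\<lambda>x. s n x - u x)) \<longlonglongrightarrow> 0)) \<and>
     \<comment> \<open>RF3: F separates points\<close>
     (\<forall>x y. x \<noteq> y \<longrightarrow> (\<exists>u\<in>F. u x \<noteq> u y)) \<and>
     \<comment> \<open>RF4: the resistance supremum is finite\<close>
     (\<forall>x y. bdd_above {\<bar>u x - u y\<bar>^2 | u. u \<in> F \<and> E u u \<le> 1}) \<and>
     \<comment> \<open>RF5: Markov property\<close>
     (\<forall>u\<in>F. (\<lambda>x. min 1 (max 0 (u x))) \<in> F \<and>
        E (\<lambda>x. min 1 (max 0 (u x))) (\<lambda>x. min 1 (max 0 (u x))) \<le> E u u)"

definition resistance_metric ::
  "(('a \<Rightarrow> real) \<Rightarrow> ('a \<Rightarrow> real) \<Rightarrow> real) \<Rightarrow> ('a \<Rightarrow> real) set \<Rightarrow> 'a \<Rightarrow> 'a \<Rightarrow> real" where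
  "resistance_metric E F x y = Sup {\<bar>u x - u y\<bar>^2 | u. u \<in> F \<and> E u u \<le> 1}"

definition resistance_topology ::
  "(('a \<Rightarrow> real) \<Rightarrow> ('a \<Rightarrow> real) \<Rightarrow> real) \<Rightarrow> ('a \<Rightarrow> real) set \<Rightarrow> 'a topology" where
  "resistance_topology E F = Metric_space.mtopology UNIV (resistance_metric E F)"

definition fsupport :: "'a topology \<Rightarrow> ('a \<Rightarrow> real) \<Rightarrow> 'a set" where
  "fsupport T u = T closure_of {x. u x \<noteq> 0}"

text \<open>Strong locality (Dirichlet form sense): E(u,v) = 0 whenever v is constant on a
  neighbourhood of the support of u (supports are compact since X is compact).\<close>
definition strongly_local ::
  "'a topology \<Rightarrow> (('a \<Rightarrow> real) \<Rightarrow> ('a \<Rightarrow> real) \<Rightarrow> real) \<Rightarrow> ('a \<Rightarrow> real) set \<Rightarrow> bool" where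
  "strongly_local T E F \<longleftrightarrow>
     (\<forall>u\<in>F. \<forall>v\<in>F. (\<exists>U c. openin T U \<and> fsupport T u \<subseteq> U \<and> (\<forall>x\<in>U. v x = c))
        \<longrightarrow> E u v = 0)"

definition arc_in :: "'a topology \<Rightarrow> (real \<Rightarrow> 'a) \<Rightarrow> 'a \<Rightarrow> 'a \<Rightarrow> bool" where
  "arc_in T g x y \<longleftrightarrow> continuous_map (top_of_set {0..1}) T g \<and> inj_on g {0..1}
      \<and> g 0 = x \<and> g 1 = y"

definition dendrite :: "'a topology \<Rightarrow> bool" where
  "dendrite T \<longleftrightarrow>
     (\<forall>x\<in>topspace T. \<forall>y\<in>topspace T. x \<noteq> y \<longrightarrow> (\<exists>g. arc_in T g x y)) \<and>
     \<not> (\<exists>S. S \<subseteq> topspace T \<and>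
            subtopology T S homeomorphic_space top_of_set (sphere (0::complex) 1))"

text \<open>Image of the (unique) arc from x to y; the degenerate case x = y gives {x}.\<close>
definition arc_image :: "'a topology \<Rightarrow> 'a \<Rightarrow> 'a \<Rightarrow> 'a set" where
  "arc_image T x y = (if x = y then {x} else \<Union>{g ` {0..1} | g. arc_in T g x y})"

definition shortest_path_metric :: "'a topology \<Rightarrow> ('a \<Rightarrow> 'a \<Rightarrow> real) \<Rightarrow> bool" where
  "shortest_path_metric T d \<longleftrightarrow> Metric_space (topspace T) d \<and>
     (\<forall>x\<in>topspace T. \<forall>y\<in>topspace T. \<forall>z\<in>arc_image T x y. d x y = d x z + d z y)"

definition borel_of_top :: "'a topology \<Rightarrow> 'a measure" where
  "borel_of_top T = sigma (topspace T) {U. openin T U}"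

definition is_energy_measure ::
  "'a topology \<Rightarrow> (('a \<Rightarrow> real) \<Rightarrow> ('a \<Rightarrow> real) \<Rightarrow> real) \<Rightarrow> ('a \<Rightarrow> real) set
   \<Rightarrow> ('a \<Rightarrow> real) \<Rightarrow> 'a measure \<Rightarrow> bool" where
  "is_energy_measure T E F f \<mu> \<longleftrightarrow>
     sets \<mu> = sets (borel_of_top T) \<and> space \<mu> = topspace T \<and> finite_measure \<mu> \<and>
     (\<forall>\<phi>\<in>F. integral\<^sup>L \<mu> \<phi> = E (\<lambda>x. \<phi> x * f x) f - E \<phi> (\<lambda>x. (f x)^2) / 2)"

definition energy_dominant ::
  "'a topology \<Rightarrow> (('a \<Rightarrow> real) \<Rightarrow> ('a \<Rightarrow> real) \<Rightarrow> real) \<Rightarrow> ('a \<Rightarrow> real) set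
   \<Rightarrow> 'a measure \<Rightarrow> bool" where
  "energy_dominant T E F m \<longleftrightarrow>
     sets m = sets (borel_of_top T) \<and> space m = topspace T \<and>
     (\<forall>U. openin T U \<and> U \<noteq> {} \<longrightarrow> emeasure m U > 0) \<and>
     (\<forall>f\<in>F. \<exists>\<mu>. is_energy_measure T E F f \<mu> \<and> absolutely_continuous m \<mu>)"

definition Gamma_le ::
  "'a topology \<Rightarrow> (('a \<Rightarrow> real) \<Rightarrow> ('a \<Rightarrow> real) \<Rightarrow> real) \<Rightarrow> ('a \<Rightarrow> real) set
   \<Rightarrow> ('a \<Rightarrow> real) \<Rightarrow> 'a measure \<Rightarrow> bool" where
  "Gamma_le T E F f m \<longleftrightarrow>
     (\<exists>\<mu> g. is_energy_measure T E F f \<mu> \<and> g \<in> borel_measurable m \<and>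
            \<mu> = density m g \<and> (AE x in m. g x \<le> 1))"

definition coordinate_sequence ::
  "'a topology \<Rightarrow> (('a \<Rightarrow> real) \<Rightarrow> ('a \<Rightarrow> real) \<Rightarrow> real) \<Rightarrow> ('a \<Rightarrow> real) set
   \<Rightarrow> 'a measure \<Rightarrow> (nat \<Rightarrow> 'a \<Rightarrow> real) \<Rightarrow> bool" where
  "coordinate_sequence T E F m fs \<longleftrightarrow>
     (\<forall>n. fs n \<in> F \<and> Gamma_le T E F (fs n) m) \<and>
     \<comment> \<open>E_1-density of the linear span: E_1(u) = E(u,u) + int u^2 dm\<close>
     (\<forall>u\<in>F. \<forall>e>0. \<exists>N c. let v = (\<lambda>x. u x - (\<Sum>i<N. c i * fs i x)) in
          E v v + integral\<^sup>L m (\<lambda>x. (v x)^2) < e)"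

definition d_Gamma ::
  "'a topology \<Rightarrow> (('a \<Rightarrow> real) \<Rightarrow> ('a \<Rightarrow> real) \<Rightarrow> real) \<Rightarrow> ('a \<Rightarrow> real) set
   \<Rightarrow> 'a measure \<Rightarrow> 'a \<Rightarrow> 'a \<Rightarrow> real" where
  "d_Gamma T E F m x y = Sup {f x - f y | f. f \<in> F \<and> Gamma_le T E F f m}"

end

theory Submission
  imports Defs
begin

text \<open>
  The supremum defining \<open>d_Gamma\<close> is finite because \<open>\<Gamma>(f) \<le> m\<close> bounds the energy of \<open>f\<close> by the mass
  of \<open>m\<close>, and it separates points because the span of a coordinate sequence is dense. For additivity
  along arcs let \<open>z\<close> be an interior point of the arc from \<open>x\<close> to \<open>y\<close>. If \<open>X - {z}\<close> splits into disjoint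
  open sets \<open>A\<close> and \<open>B\<close> containing \<open>x\<close> and \<open>y\<close>, then functions \<open>f\<close> and \<open>g\<close> that vanish at \<open>z\<close> can be
  glued to \<open>h = 1_A f + 1_B g\<close>; by locality the energy measure of \<open>h\<close> is \<open>1_A \<Gamma>(f) + 1_B \<Gamma>(g)\<close>, since
  energy measures do not charge points, and hence \<open>d(x,z) + d(z,y) \<le> d(x,y)\<close>.

  The absence of circles yields such a splitting only together with local path connectedness, which
  fails for general arcwise connected compacta without circles (the harmonic fan). Here it comes from
  the form: restricting a function to a relatively clopen part of an open set increases its
  energy at most by a constant factor, so resistance balls lie in a single quasi-component, and quasi-components are
  refined to paths by chains.
\<close>

section \<open>Local path connectedness and separation by points of arcs\<close>

text \<open>The axioms make \<open>F\<close> only a vector space stable under the unit contraction,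
  while energy measures need products and gluing needs restrictions to sets. Both pass through one
  principle, \<open>F_closure\<close>: a uniform limit of functions of bounded energy lies in
  \<open>F\<close>, and suitable approximants converge to it in energy. For squares the energy bound
  comes from layers of a function, whose mutual energies are nonnegative; for restrictions it comes
  from soft thresholding, which moves the support off the zero set and costs a factor 4.

  Strong locality speaks of functions constant near a support, whereas the two sides of
  \<open>z\<close> touch at \<open>z\<close>; thresholding bridges this gap as well.

  \<open>m\<close> may have an atom at \<open>z\<close>, so the glued density is set to 0 there, and
  it has to be proved that no energy sits at \<open>z\<close>. Test functions vanishing at
  \<open>z\<close> split between the two sides; constants do not, and are recovered from cutoffs
  shrinking to \<open>z\<close>.

  In the topological part the order of choices matters: closeness is fixed before the mesh of a
  chain, and the number of links must not depend on the end points, so that refinement can be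
  iterated.\<close>

definition locally_quasi_connected :: "'b::metric_space set \<Rightarrow> bool" where
  "locally_quasi_connected S \<longleftrightarrow> (\<forall>W x. openin (top_of_set S) W \<longrightarrow> x \<in> W \<longrightarrow>
    (\<exists>r>0. \<forall>V. V \<subseteq> W \<and> x \<in> V \<and> openin (top_of_set S) V \<and> openin (top_of_set S) (W - V)
      \<longrightarrow> S \<inter> ball x r \<subseteq> V))"

text \<open>\<open>locally_quasi_connected\<close> makes the quasi-component of \<open>x\<close> in
  \<open>W\<close>, the intersection of the relatively clopen sets containing \<open>x\<close>, a
  neighbourhood of \<open>x\<close>: one radius serves all clopen sets. Points of \<open>W\<close>
  reached from \<open>x\<close> by chains of net points form such a clopen set, so a whole ball is
  reachable. \<open>\<delta>\<close> precedes \<open>\<eta>\<close>, and \<open>k\<close> serves all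
  pairs; both are needed to refine chains repeatedly.\<close>

lemma uniform_chains:
  fixes S :: "'b::metric_space set"
  assumes "compact S"
    and quasi: "locally_quasi_connected S"
    and "0 < \<epsilon>"
  shows "\<exists>\<delta>>0. \<forall>\<eta>>0. \<exists>k>0. \<forall>x\<in>S. \<forall>y\<in>S. dist x y < \<delta> \<longrightarrow>
    (\<exists>c::nat \<Rightarrow> 'b. c 0 = x \<and> c k = y \<and> (\<forall>i\<le>k. c i \<in> S \<and> dist x (c i) < \<epsilon>) \<and>
      (\<forall>i<k. dist (c i) (c (Suc i)) < \<eta>))"
proof -
  have "\<exists>r>0. r \<le> \<epsilon>/4 \<and> (\<forall>V. V \<subseteq> S \<inter> ball x (\<epsilon>/4) \<and> x \<in> V \<and> openin (top_of_set S) V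
     \<and> openin (top_of_set S) (S \<inter> ball x (\<epsilon>/4) - V) \<longrightarrow> S \<inter> ball x r \<subseteq> V)" if "x \<in> S" for x
  proof -
    have "openin (top_of_set S) (S \<inter> ball x (\<epsilon>/4))" "x \<in> S \<inter> ball x (\<epsilon>/4)"
      using that \<open>0 < \<epsilon>\<close> by (auto simp: openin_open_Int)
    from quasi[unfolded locally_quasi_connected_def, rule_format, OF this] obtain r where "r > 0" and r: "\<And>V. V \<subseteq> S \<inter> ball x (\<epsilon>/4) \<and> x \<in> V \<and> openin (top_of_set S) V
     \<and> openin (top_of_set S) (S \<inter> ball x (\<epsilon>/4) - V) \<Longrightarrow> S \<inter> ball x r \<subseteq> V" by metis
    have "S \<inter> ball x (min r (\<epsilon>/4)) \<subseteq> S \<inter> ball x r" by auto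
    then show ?thesis using r \<open>r > 0\<close> \<open>0 < \<epsilon>\<close>
      by (intro exI[of _ "min r (\<epsilon>/4)"]) (auto dest!: r)
  qed
  then obtain r where r0: "\<And>x. x \<in> S \<Longrightarrow> r x > 0" and r4: "\<And>x. x \<in> S \<Longrightarrow> r x \<le> \<epsilon>/4"
    and r: "\<And>x V. x \<in> S \<Longrightarrow> V \<subseteq> S \<inter> ball x (\<epsilon>/4) \<Longrightarrow> x \<in> V \<Longrightarrow> openin (top_of_set S) V
     \<Longrightarrow> openin (top_of_set S) (S \<inter> ball x (\<epsilon>/4) - V) \<Longrightarrow> S \<inter> ball x (r x) \<subseteq> V"
    by metis
  obtain D where D: "D \<subseteq> S" "finite D" "S \<subseteq> (\<Union>x\<in>D. ball x (r x/2))"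
    using compactE_image[OF \<open>compact S\<close>, of S "\<lambda>x. ball x (r x/2)"] r0 by force
  \<comment> \<open>Half the radius at the centres of a finite cover: two points closer than
    \<open>\<delta>\<close> then lie in one ball \<open>ball x (r x)\<close>.\<close>
  define \<delta> where "\<delta> = Min (insert 1 ((\<lambda>x. r x/2) ` D))"
  have d0: "\<delta> > 0" unfolding \<delta>_def using D r0 by (subst Min_gr_iff) auto
  have dr: "\<delta> \<le> r x / 2" if "x \<in> D" for x unfolding \<delta>_def using D that by (intro Min_le) auto
  have main: "\<exists>k>0. \<forall>x\<in>S. \<forall>y\<in>S. dist x y < \<delta> \<longrightarrow>
    (\<exists>c::nat \<Rightarrow> 'b. c 0 = x \<and> c k = y \<and> (\<forall>i\<le>k. c i \<in> S \<and> dist x (c i) < \<epsilon>) \<and>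
      (\<forall>i<k. dist (c i) (c (Suc i)) < \<eta>))" if "0 < \<eta>" "\<eta> \<le> \<epsilon>/4" for \<eta>
  proof -
    obtain A where A: "A \<subseteq> S" "finite A" "S \<subseteq> (\<Union>x\<in>A. ball x (\<eta>/3))"
      using compactE_image[OF \<open>compact S\<close>, of S "\<lambda>x. ball x (\<eta>/3)"] \<open>0 < \<eta>\<close> by force
    \<comment> \<open>Reachability in a finite relation takes at most as many steps as the relation
      has pairs, whence a bound independent of the end points.\<close>
    define N where "N = card (A \<times> A)"
    have "\<exists>c::nat \<Rightarrow> 'b. c 0 = p \<and> c (Suc (Suc N)) = q \<and> (\<forall>i\<le>Suc (Suc N). c i \<in> S \<and> dist p (c i) < \<epsilon>) \<and>
      (\<forall>i<Suc (Suc N). dist (c i) (c (Suc i)) < \<eta>)" if pq: "p \<in> S" "q \<in> S" "dist p q < \<delta>" for p q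
    proof -
      have "p \<in> (\<Union>x\<in>D. ball x (r x/2))" using pq D(3) by blast
      then obtain x where x: "x \<in> D" "dist x p < r x / 2" by auto
      then have xS: "x \<in> S" using D by auto
      have "dist x q \<le> dist x p + dist p q" by (rule dist_triangle)
      then have xq: "dist x q < r x" using x pq dr[OF x(1)] by linarith
      define W where "W = S \<inter> ball x (\<epsilon>/4)"
      define A' where "A' = {a\<in>A. dist x a < \<epsilon>/4 + \<eta>/3}"
      define R where "R = {(a,b). a \<in> A' \<and> b \<in> A' \<and> dist a b < \<eta>}"
      have symR: "sym R" unfolding R_def sym_def by (auto simp: dist_commute)
      have net: "\<exists>a\<in>A'. dist a v < \<eta>/3" if "v \<in> W" for v
      proof -
        have "v \<in> (\<Union>x\<in>A. ball x (\<eta>/3))" using that A(3) unfolding W_def by blast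
        then obtain a where a: "a \<in> A" "dist a v < \<eta>/3" by auto
        have "dist x a \<le> dist x v + dist a v" by (metis dist_triangle dist_commute)
        then show ?thesis using a that unfolding W_def A'_def by force
      qed
      have xW: "x \<in> W" using xS \<open>0 < \<epsilon>\<close> W_def by auto
      obtain a0 where a0: "a0 \<in> A'" "dist a0 x < \<eta>/3" using net[OF xW] by auto
      define V where "V = W \<inter> (\<Union>a\<in>R\<^sup>* `` {a0}. ball a (\<eta>/3))"
      \<comment> \<open>Net points within \<open>\<eta>/3\<close> of a common point are closer than
        \<open>\<eta>\<close>, hence related. So the complement of \<open>V\<close> in
        \<open>W\<close> is again cut out by balls around net points, and \<open>V\<close> is clopen
        in \<open>W\<close>.\<close>
      have WV: "W - V = W \<inter> (\<Union>a\<in>A' - R\<^sup>* `` {a0}. ball a (\<eta>/3))"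
      proof (intro equalityI subsetI)
        fix v assume v: "v \<in> W - V"
        then obtain a where "a \<in> A'" "dist a v < \<eta>/3" using net by blast
        then show "v \<in> W \<inter> (\<Union>a\<in>A' - R\<^sup>* `` {a0}. ball a (\<eta>/3))" using v V_def by auto
      next
        fix v assume v: "v \<in> W \<inter> (\<Union>a\<in>A' - R\<^sup>* `` {a0}. ball a (\<eta>/3))"
        then obtain a where a: "a \<in> A'" "(a0,a) \<notin> R\<^sup>*" "dist a v < \<eta>/3" by auto
        have "v \<notin> V"
        proof
          assume "v \<in> V"
          then obtain b where b: "(a0,b) \<in> R\<^sup>*" "dist b v < \<eta>/3" by (auto simp: V_def)
          have bA: "b \<in> A'" using b(1) a0 by (induction rule: rtrancl_induct) (auto simp: R_def)
          have "dist b a \<le> dist b v + dist a v" by (metis dist_triangle dist_commute)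
          then have "(b,a) \<in> R" using a b bA \<open>0 < \<eta>\<close> by (auto simp: R_def)
          then show False using a b by (meson rtrancl.rtrancl_into_rtrancl)
        qed
        then show "v \<in> W - V" using v by auto
      qed
      have oW: "openin (top_of_set S) W" unfolding W_def by (auto simp: openin_open_Int)
      have "openin (top_of_set S) V" unfolding V_def
        using oW by (intro openin_Int_open) auto
      moreover have "openin (top_of_set S) (W - V)" unfolding WV
        using oW by (intro openin_Int_open) auto
      moreover have "x \<in> V" using xW a0 V_def by auto
      ultimately have sub: "S \<inter> ball x (r x) \<subseteq> V"
        using r[OF xS, of V] unfolding V_def W_def by auto
      have "p \<in> V" "q \<in> V" using sub pq x xq r0[OF xS] by auto
      then obtain a b where ab: "(a0,a) \<in> R\<^sup>*" "dist a p < \<eta>/3" "(a0,b) \<in> R\<^sup>*" "dist b q < \<eta>/3"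
        by (auto simp: V_def)
      have "(a,b) \<in> R\<^sup>*" using ab symR by (meson rtrancl_trans sym_rtrancl symD)
      have finR: "finite R" "card R \<le> N"
      proof -
        have "R \<subseteq> A \<times> A" by (auto simp: R_def A'_def)
        moreover have "finite (A \<times> A)" using A by simp
        ultimately show "finite R" "card R \<le> N" unfolding N_def by (rule finite_subset, rule card_mono[rotated])
      qed
      obtain n where n: "n \<le> N" "(a,b) \<in> R ^^ n"
        using \<open>(a,b) \<in> R\<^sup>*\<close> finR rtrancl_finite_eq_relpow[of R] by (metis (no_types, lifting) UN_E le_trans mem_Collect_eq)
      have bA: "b \<in> A'" using ab(3) a0 by (induction rule: rtrancl_induct) (auto simp: R_def)
      \<comment> \<open>Repeating the last net point pads every chain to the length
        \<open>N\<close>; the two extra links in \<open>Suc (Suc N)\<close> attach \<open>p\<close>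
        and \<open>q\<close>.\<close>
      have "(b,b) \<in> R" using bA \<open>0 < \<eta>\<close> by (auto simp: R_def)
      then have "(b,b) \<in> R ^^ j" for j by (induction j) auto
      then have "(a,b) \<in> R ^^ (n + (N - n))" using n by (metis relcomp.relcompI relpow_add)
      then have "(a,b) \<in> R ^^ N" using n by simp
      then obtain f where f: "f 0 = a" "f N = b" "\<And>i. i < N \<Longrightarrow> (f i, f (Suc i)) \<in> R"
        by (auto simp: relpow_fun_conv)
      have fA: "f i \<in> A'" if "i \<le> N" for i
        using that f bA by (cases "i = N") (auto simp: R_def)
      define c where "c = case_nat p (\<lambda>j. if j \<le> N then f j else q)"
      have px: "dist p x < \<epsilon>/8" using x r4[OF xS] by (simp add: dist_commute)
      have fd: "f i \<in> S \<and> dist p (f i) < \<epsilon>" if "i \<le> N" for i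
      proof -
        have "dist p (f i) \<le> dist p x + dist x (f i)" by (rule dist_triangle)
        also have "\<dots> < \<epsilon>/8 + (\<epsilon>/4 + \<eta>/3)" using fA[OF that] px by (auto simp: A'_def)
        finally show ?thesis using fA[OF that] A \<open>\<eta> \<le> \<epsilon>/4\<close> \<open>0 < \<epsilon>\<close> by (auto simp: A'_def)
      qed
      have "dist p q \<le> dist p x + dist x q" by (rule dist_triangle)
      then have pqe: "dist p q < \<epsilon>" using px xq r4[OF xS] \<open>0 < \<epsilon>\<close> by linarith
      have "c i \<in> S \<and> dist p (c i) < \<epsilon>" for i
        using fd pq pqe \<open>0 < \<epsilon>\<close> by (auto simp: c_def split: nat.splits)
      moreover have "dist (c i) (c (Suc i)) < \<eta>" if "i < Suc (Suc N)" for i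
      proof (cases i)
        case 0 then show ?thesis using ab f \<open>0 < \<eta>\<close> by (simp add: c_def dist_commute)
      next
        case (Suc j)
        show ?thesis
        proof (cases "j < N")
          case True then show ?thesis using f(3)[of j] Suc by (simp add: c_def R_def)
        next
          case False then have "j = N" using that Suc by auto
          then show ?thesis using Suc f ab \<open>0 < \<eta>\<close> by (simp add: c_def)
        qed
      qed
      moreover have "c 0 = p" "c (Suc (Suc N)) = q" by (auto simp: c_def)
      ultimately show ?thesis by blast
    qed
    then show ?thesis by blast
  qed
  show ?thesis
  proof (intro exI[of _ \<delta>] conjI d0 allI impI)
    fix \<eta> :: real assume "0 < \<eta>"
    then have "0 < min \<eta> (\<epsilon>/4)" "min \<eta> (\<epsilon>/4) \<le> \<epsilon>/4" using \<open>0 < \<epsilon>\<close> by auto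
    from main[OF this] obtain k where k: "k > 0" "\<forall>x\<in>S. \<forall>y\<in>S. dist x y < \<delta> \<longrightarrow>
      (\<exists>c::nat \<Rightarrow> 'b. c 0 = x \<and> c k = y \<and> (\<forall>i\<le>k. c i \<in> S \<and> dist x (c i) < \<epsilon>) \<and>
      (\<forall>i<k. dist (c i) (c (Suc i)) < min \<eta> (\<epsilon>/4)))" by (elim exE conjE)
    then show "\<exists>k>0. \<forall>x\<in>S. \<forall>y\<in>S. dist x y < \<delta> \<longrightarrow>
      (\<exists>c::nat \<Rightarrow> 'b. c 0 = x \<and> c k = y \<and> (\<forall>i\<le>k. c i \<in> S \<and> dist x (c i) < \<epsilon>) \<and>
      (\<forall>i<k. dist (c i) (c (Suc i)) < \<eta>))" by (metis min_less_iff_conj)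
  qed
qed

text \<open>Each link is replaced by a finer chain with the same number \<open>k n\<close> of links,
  so the points of stage \<open>n\<close> belong consistently to the multiples of
  \<open>1 / K n\<close>. A refinement moves a point by less than
  \<open>\<epsilon> / 2^(n+2)\<close>, so the step functions converge uniformly; their jumps at
  stage \<open>n\<close> are below \<open>d n\<close>, so the limit is continuous.\<close>

lemma path_of_refining_chains:
  fixes S :: "'b::complete_space set" and k :: "nat \<Rightarrow> nat"
    and link :: "nat \<Rightarrow> 'b \<Rightarrow> 'b \<Rightarrow> nat \<Rightarrow> 'b"
  assumes "closed S" "0 < \<epsilon>" "\<And>n. 0 < d n" "\<And>n. d n \<le> \<epsilon> / 2^(n+2)" "\<And>n. 0 < k n"
    and link: "\<And>n x y. x \<in> S \<Longrightarrow> y \<in> S \<Longrightarrow> dist x y < d n \<Longrightarrow>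
      link n x y 0 = x \<and> link n x y (k n) = y \<and>
      (\<forall>i\<le>k n. link n x y i \<in> S \<and> dist x (link n x y i) < \<epsilon> / 2^(n+2)) \<and>
      (\<forall>i<k n. dist (link n x y i) (link n x y (Suc i)) < d (Suc n))"
    and "a \<in> S" "b \<in> S" "dist a b < d 0"
  shows "\<exists>g. path g \<and> path_image g \<subseteq> S \<inter> ball a \<epsilon> \<and> pathstart g = a \<and> pathfinish g = b"
proof -
  define e where "e n = \<epsilon> / 2^(n+2)" for n
  have e: "e n > 0" "e (Suc n) = e n / 2" for n using \<open>0 < \<epsilon>\<close> by (auto simp: e_def)
  \<comment> \<open>Stages are infinite sequences, which avoids bounds on indices; stage 0 is
    \<open>a, b, b, ...\<close>. Entry \<open>l\<close> of the next stage sits in link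
    \<open>l div k n\<close> at place \<open>l mod k n\<close>. The part from \<open>a\<close> to
    \<open>b\<close> consists of the indices up to \<open>K n\<close>.\<close>
  define c where "c = rec_nat (\<lambda>j::nat. if j = 0 then a else b)
    (\<lambda>n cn l. link n (cn (l div k n)) (cn (Suc (l div k n))) (l mod k n))"
  have c0: "c 0 j = (if j = 0 then a else b)" for j by (simp add: c_def)
  have cS: "c (Suc n) l = link n (c n (l div k n)) (c n (Suc (l div k n))) (l mod k n)" for n l
    by (simp add: c_def)
  have inv: "(\<forall>j. c n j \<in> S \<and> dist (c n j) (c n (Suc j)) < d n)" for n
  proof (induction n)
    case 0 then show ?case using assms by (auto simp: c0)
  next
    case (Suc n)
    note L = link[of "c n j" "c n (Suc j)" n for j, OF Suc[rule_format, THEN conjunct1] Suc[rule_format, THEN conjunct1] Suc[rule_format, THEN conjunct2]]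
    show ?case
    proof (intro allI conjI)
      fix l
      have lt: "l mod k n < k n" using \<open>0 < k n\<close> by simp
      then show "c (Suc n) l \<in> S" unfolding cS using L[of "l div k n"] by auto
      show "dist (c (Suc n) l) (c (Suc n) (Suc l)) < d (Suc n)"
      proof (cases "Suc (l mod k n) = k n")
        \<comment> \<open>The successor opens the next block, whose first point is the last point of
          the present one.\<close>
        case True
        then have "Suc l mod k n = 0" "Suc l div k n = Suc (l div k n)"
          by (auto simp: mod_Suc div_Suc)
        then have "c (Suc n) (Suc l) = link n (c n (l div k n)) (c n (Suc (l div k n))) (Suc (l mod k n))"
          unfolding cS using L[of "l div k n"] L[of "Suc (l div k n)"] True by simp
        then show ?thesis unfolding cS[of n l] using L[of "l div k n"] lt by simp
      next
        case False
        then have "Suc l mod k n = Suc (l mod k n)" "Suc l div k n = l div k n"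
          using \<open>0 < k n\<close> by (auto simp: mod_Suc div_Suc)
        then show ?thesis unfolding cS using L[of "l div k n"] lt by simp
      qed
    qed
  qed
  have step: "dist (c n (l div k n)) (c (Suc n) l) < e n" for n l
    unfolding cS e_def using link[of "c n (l div k n)" "c n (Suc (l div k n))" n] inv[of n] \<open>0 < k n\<close> less_imp_le[OF mod_less_divisor[of "k n" l]]
    by auto
  define K where "K n = (\<Prod>i<n. k i)" for n
  have K: "K 0 = 1" "K (Suc n) = K n * k n" "K n > 0" for n using assms(5) by (auto simp: K_def prod_pos)
  have ca: "c n 0 = a" for n
  proof (induction n)
    case (Suc n)
    then show ?case unfolding cS using link[of "c n 0" "c n (Suc 0)" n] inv[of n] by auto
  qed (simp add: c0)
  have cb: "c n (K n) = b" for n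
  proof (induction n)
    case (Suc n)
    have "c (Suc n) (K (Suc n)) = c n (K n)" unfolding cS K
      using link[of "c n (K n)" "c n (Suc (K n))" n] inv[of n] \<open>0 < k n\<close> by auto
    then show ?case using Suc by simp
  qed (simp add: c0 K)
  define f where "f n t = c n (nat \<lfloor>t * real (K n)\<rfloor>)" for n and t :: real
  have fl: "nat \<lfloor>t * real (K (Suc n))\<rfloor> div k n = nat \<lfloor>t * real (K n)\<rfloor>" if "t \<ge> 0" for t n
  proof -
    have "\<lfloor>t * real (K n)\<rfloor> = \<lfloor>t * real (K (Suc n)) / real_of_int (int (k n))\<rfloor>"
      using \<open>0 < k n\<close> by (simp add: K)
    also have "\<dots> = \<lfloor>t * real (K (Suc n))\<rfloor> div int (k n)" by (rule floor_divide_real_eq_div) simp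
    finally show ?thesis using that by (simp add: nat_div_distrib)
  qed
  have fstep: "dist (f n t) (f (Suc n) t) < e n" if "t \<ge> 0" for n t
    using step[of n "nat \<lfloor>t * real (K (Suc n))\<rfloor>"] unfolding fl[OF that] f_def .
  \<comment> \<open>As \<open>e (Suc n) = e n / 2\<close>, the steps from stage \<open>n\<close> to
    stage \<open>n + j\<close> sum to exactly this difference.\<close>
  have ftail: "dist (f n t) (f (n + j) t) \<le> 2 * e n - 2 * e (n + j)" if "t \<ge> 0" for n j t
  proof (induction j)
    case (Suc j)
    have "dist (f n t) (f (n + Suc j) t) \<le> dist (f n t) (f (n + j) t) + dist (f (n+j) t) (f (n + Suc j) t)"
      by (rule dist_triangle)
    then show ?case using Suc fstep[OF that, of "n+j"] e(2)[of "n+j"] by simp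
  qed simp
  have e0: "e \<longlonglongrightarrow> 0"
  proof -
    have "(\<lambda>n. (\<epsilon>/4) * (1/2)^n) \<longlonglongrightarrow> (\<epsilon>/4) * 0" by (intro tendsto_intros LIMSEQ_power_zero) auto
    moreover have "e = (\<lambda>n. (\<epsilon>/4) * (1/2)^n)" by (auto simp: e_def power_divide)
    ultimately show ?thesis by simp
  qed
  have ft: "dist (f n t) (f m t) \<le> 2 * e n" if "t \<ge> 0" "n \<le> m" for n m t
    using ftail[OF that(1), of n "m - n"] e(1)[of m] that by simp
  have "convergent (\<lambda>n. f n t)" if "t \<ge> 0" for t
  proof (rule Cauchy_convergent, rule metric_CauchyI)
    fix x :: real assume "x > 0"
    then have "\<forall>\<^sub>F n in sequentially. e n < x/4" using order_tendstoD(2)[OF e0, of "x/4"] by simp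
    then obtain M where M: "e M < x/4" by (meson eventually_sequentially order_refl)
    have "dist (f m t) (f n t) < x" if "m \<ge> M" "n \<ge> M" for m n
    proof -
      have "dist (f m t) (f n t) \<le> dist (f M t) (f m t) + dist (f M t) (f n t)" by (metis dist_triangle dist_commute)
      then show ?thesis using ft[OF \<open>t \<ge> 0\<close> that(1)] ft[OF \<open>t \<ge> 0\<close> that(2)] M by linarith
    qed
    then show "\<exists>M. \<forall>m\<ge>M. \<forall>n\<ge>M. dist (f m t) (f n t) < x" by blast
  qed
  then have lim: "(\<lambda>n. f n t) \<longlonglongrightarrow> lim (\<lambda>n. f n t)" if "t \<ge> 0" for t using that convergent_LIMSEQ_iff by blast
  define g where "g t = lim (\<lambda>n. f n t)" for t
  have fg: "dist (f n t) (g t) \<le> 2 * e n" if "t \<ge> 0" for n t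
  proof (rule LIMSEQ_le_const2[where X = "\<lambda>m. dist (f n t) (f m t)"])
    show "(\<lambda>m. dist (f n t) (f m t)) \<longlonglongrightarrow> dist (f n t) (g t)"
      unfolding g_def by (intro tendsto_intros lim that)
    show "\<exists>N. \<forall>m\<ge>N. dist (f n t) (f m t) \<le> 2 * e n" using ft[OF that] by blast
  qed
  have gS: "g t \<in> S" if "t \<ge> 0" for t
    using closed_sequentially[OF \<open>closed S\<close> _ lim[OF that]] inv unfolding g_def f_def by blast
  have g01: "g 0 = a" "g 1 = b" unfolding g_def f_def by (auto simp: ca cb)
  have "uniformly_continuous_on {0..1} g" unfolding uniformly_continuous_on_def
  proof (intro allI impI)
    fix x :: real assume "x > 0"
    \<comment> \<open>Five errors: \<open>2 * e n\<close> for each of the two passages from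
      \<open>g\<close> to stage \<open>n\<close>, and one \<open>e n\<close> between adjacent
      entries.\<close>
    then have "\<forall>\<^sub>F n in sequentially. e n < x/5" using order_tendstoD(2)[OF e0, of "x/5"] by simp
    then obtain n where n: "e n < x/5" by (meson eventually_sequentially order_refl)
    have close: "dist (g t) (g s) < x" if ts: "0 \<le> s" "s \<le> t" "t - s < 1 / real (K n)" for s t
    proof -
      have "t * real (K n) < s * real (K n) + 1" using ts K(3)[of n] by (simp add: field_simps)
      moreover have "s * real (K n) \<le> t * real (K n)" using ts by (intro mult_right_mono) auto
      ultimately have "\<lfloor>s * real (K n)\<rfloor> \<le> \<lfloor>t * real (K n)\<rfloor>" "\<lfloor>t * real (K n)\<rfloor> \<le> \<lfloor>s * real (K n)\<rfloor> + 1"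
        by linarith+
      moreover have "0 \<le> \<lfloor>s * real (K n)\<rfloor>" using ts by simp
      ultimately have "nat \<lfloor>t * real (K n)\<rfloor> = nat \<lfloor>s * real (K n)\<rfloor> \<or> nat \<lfloor>t * real (K n)\<rfloor> = Suc (nat \<lfloor>s * real (K n)\<rfloor>)"
        by linarith
      then have "dist (f n t) (f n s) \<le> e n"
      proof
        assume "nat \<lfloor>t * real (K n)\<rfloor> = nat \<lfloor>s * real (K n)\<rfloor>"
        then show ?thesis using e(1)[of n] by (simp add: f_def)
      next
        assume "nat \<lfloor>t * real (K n)\<rfloor> = Suc (nat \<lfloor>s * real (K n)\<rfloor>)"
        then have "dist (f n s) (f n t) < d n" using inv[of n] by (simp add: f_def)
        then show ?thesis using assms(4)[of n] by (simp add: e_def dist_commute)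
      qed
      moreover have "dist (g t) (g s) \<le> dist (f n t) (g t) + dist (f n t) (f n s) + dist (f n s) (g s)"
        by (smt (verit) dist_triangle dist_commute)
      ultimately show ?thesis using fg[of t n] fg[of s n] ts n by linarith
    qed
    have "dist (g t) (g s) < x" if "s \<in> {0..1}" "t \<in> {0..1}" "dist t s < 1 / real (K n)" for s t
      using close[of s t] close[of t s] that by (cases "s \<le> t") (auto simp: dist_real_def dist_commute)
    then show "\<exists>d>0. \<forall>x'\<in>{0..1}. \<forall>xa\<in>{0..1}. dist xa x' < d \<longrightarrow> dist (g xa) (g x') < x"
      using K(3)[of n] by (intro exI[of _ "1 / real (K n)"]) auto
  qed
  then have "path g" unfolding path_def by (rule uniformly_continuous_imp_continuous)
  \<comment> \<open>At stage 0 the value is \<open>a\<close> on \<open>[0,1)\<close> and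
    \<open>b\<close> at 1, hence the case distinction.\<close>
  moreover have "g t \<in> ball a \<epsilon>" if "t \<in> {0..1}" for t
  proof (cases "t = 1")
    case True
    have "d 0 < \<epsilon>" using assms(4)[of 0] \<open>0 < \<epsilon>\<close> by simp
    then show ?thesis using True g01 assms by auto
  next
    case False
    then have "nat \<lfloor>t\<rfloor> = 0" using that by (auto simp: floor_less_iff)
    then have "f 0 t = a" by (simp add: f_def K c0)
    then have "dist a (g t) \<le> 2 * e 0" using fg[of t 0] that by simp
    also have "\<dots> < \<epsilon>" using \<open>0 < \<epsilon>\<close> by (simp add: e_def)
    finally show ?thesis by simp
  qed
  ultimately show ?thesis using gS g01 by (intro exI[of _ g]) (auto simp: path_image_def pathstart_def pathfinish_def)
qed

text \<open>Since \<open>\<delta> n\<close> does not depend on the mesh of the chains, all the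
  \<open>d n\<close> can be fixed beforehand; only then is \<open>k n\<close> taken for the mesh
  \<open>d (Suc n)\<close>.\<close>

lemma short_paths:
  fixes S :: "'b::complete_space set"
  assumes "compact S"
    and quasi: "locally_quasi_connected S"
    and "0 < \<epsilon>"
  shows "\<exists>\<delta>>0. \<forall>x\<in>S. \<forall>y\<in>S. dist x y < \<delta> \<longrightarrow>
    (\<exists>g. path g \<and> path_image g \<subseteq> S \<inter> ball x \<epsilon> \<and> pathstart g = x \<and> pathfinish g = y)"
proof -
  have "\<forall>n. \<exists>\<delta>>0. \<forall>\<eta>>0. \<exists>k>0. \<forall>x\<in>S. \<forall>y\<in>S. dist x y < \<delta> \<longrightarrow>
    (\<exists>c::nat \<Rightarrow> 'b. c 0 = x \<and> c k = y \<and> (\<forall>i\<le>k. c i \<in> S \<and> dist x (c i) < \<epsilon> / 2^(n+2)) \<and>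
      (\<forall>i<k. dist (c i) (c (Suc i)) < \<eta>))"
    by (intro allI uniform_chains[OF assms(1) quasi]) (use \<open>0 < \<epsilon>\<close> in auto)
  from choice[OF this] obtain \<delta> where \<delta>: "\<forall>n. \<delta> n > 0 \<and> (\<forall>\<eta>>0. \<exists>k>0. \<forall>x\<in>S. \<forall>y\<in>S. dist x y < \<delta> n \<longrightarrow>
    (\<exists>c::nat \<Rightarrow> 'b. c 0 = x \<and> c k = y \<and> (\<forall>i\<le>k. c i \<in> S \<and> dist x (c i) < \<epsilon> / 2^(n+2)) \<and>
      (\<forall>i<k. dist (c i) (c (Suc i)) < \<eta>)))" by (rule exE)
  define d where "d n = min (\<delta> n) (\<epsilon> / 2^(n+2))" for n
  have d0: "d n > 0" "d n \<le> \<epsilon> / 2^(n+2)" for n using \<delta> \<open>0 < \<epsilon>\<close> by (simp_all add: d_def)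
  have "\<forall>n. \<exists>k>0. \<forall>x\<in>S. \<forall>y\<in>S. dist x y < d n \<longrightarrow>
    (\<exists>c::nat \<Rightarrow> 'b. c 0 = x \<and> c k = y \<and> (\<forall>i\<le>k. c i \<in> S \<and> dist x (c i) < \<epsilon> / 2^(n+2)) \<and>
      (\<forall>i<k. dist (c i) (c (Suc i)) < d (Suc n)))"
  proof
    fix n
    have "\<exists>k>0. \<forall>x\<in>S. \<forall>y\<in>S. dist x y < \<delta> n \<longrightarrow>
    (\<exists>c::nat \<Rightarrow> 'b. c 0 = x \<and> c k = y \<and> (\<forall>i\<le>k. c i \<in> S \<and> dist x (c i) < \<epsilon> / 2^(n+2)) \<and>
      (\<forall>i<k. dist (c i) (c (Suc i)) < d (Suc n)))"
      using \<delta>[THEN spec[of _ n], THEN conjunct2, THEN spec, THEN mp, OF d0(1)[of "Suc n"]] .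
    then obtain k where k: "k > 0" "\<And>x y. x \<in> S \<Longrightarrow> y \<in> S \<Longrightarrow> dist x y < \<delta> n \<Longrightarrow>
      \<exists>c::nat \<Rightarrow> 'b. c 0 = x \<and> c k = y \<and> (\<forall>i\<le>k. c i \<in> S \<and> dist x (c i) < \<epsilon> / 2^(n+2)) \<and>
      (\<forall>i<k. dist (c i) (c (Suc i)) < d (Suc n))" by auto
    show "\<exists>k>0. \<forall>x\<in>S. \<forall>y\<in>S. dist x y < d n \<longrightarrow>
    (\<exists>c::nat \<Rightarrow> 'b. c 0 = x \<and> c k = y \<and> (\<forall>i\<le>k. c i \<in> S \<and> dist x (c i) < \<epsilon> / 2^(n+2)) \<and>
      (\<forall>i<k. dist (c i) (c (Suc i)) < d (Suc n)))"
      by (intro exI[of _ k] conjI ballI impI k) (auto simp: d_def)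
  qed
  from choice[OF this] obtain k where k: "\<forall>n. k n > 0 \<and> (\<forall>x\<in>S. \<forall>y\<in>S. dist x y < d n \<longrightarrow>
    (\<exists>c::nat \<Rightarrow> 'b. c 0 = x \<and> c (k n) = y \<and> (\<forall>i\<le>k n. c i \<in> S \<and> dist x (c i) < \<epsilon> / 2^(n+2)) \<and>
      (\<forall>i<k n. dist (c i) (c (Suc i)) < d (Suc n))))" by (rule exE)
  have k0: "k n > 0" for n using k[THEN spec, of n] by (rule conjunct1)
  define link where "link n x y = (SOME c. c 0 = x \<and> c (k n) = y \<and> (\<forall>i\<le>k n. c i \<in> S \<and> dist x (c i) < \<epsilon> / 2^(n+2)) \<and>
      (\<forall>i<k n. dist (c i) (c (Suc i)) < d (Suc n)))" for n x y
  have "link n x y 0 = x \<and> link n x y (k n) = y \<and>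
      (\<forall>i\<le>k n. link n x y i \<in> S \<and> dist x (link n x y i) < \<epsilon> / 2^(n+2)) \<and>
      (\<forall>i<k n. dist (link n x y i) (link n x y (Suc i)) < d (Suc n))" if "x \<in> S" "y \<in> S" "dist x y < d n" for n x y
    unfolding link_def by (rule someI_ex[OF k[THEN spec, THEN conjunct2, THEN bspec, THEN bspec, THEN mp, OF that]])
  from path_of_refining_chains[OF compact_imp_closed[OF \<open>compact S\<close>] \<open>0 < \<epsilon>\<close> d0 k0 this]
  show ?thesis using d0(1)[of 0] by blast
qed

text \<open>The upper half circle is mapped to \<open>g\<close> and the lower half circle to \<open>p\<close>, both parametrised
  by the real part.\<close>

lemma circle_of_two_arcs:
  fixes g p :: "real \<Rightarrow> 'b::metric_space"
  assumes "arc g" "arc p" "pathstart g = pathstart p" "pathfinish g = pathfinish p"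
    and z: "z \<in> path_image g" "z \<notin> path_image p"
  shows "\<exists>C \<subseteq> path_image g \<union> path_image p. C homeomorphic sphere (0::complex) 1"
proof -
  have cg: "continuous_on {0..1} g" and ig: "inj_on g {0..1}" and cp: "continuous_on {0..1} p" and ip: "inj_on p {0..1}"
    using assms by (auto simp: arc_def path_def)
  obtain t0 where t0: "t0 \<in> {0..1}" "g t0 = z" using z by (auto simp: path_image_def)
  \<comment> \<open>Times at which \<open>g\<close> meets \<open>p\<close>. The gap of
    \<open>P\<close> around \<open>t0\<close> has end points \<open>a\<close> and \<open>b\<close>
    in \<open>P\<close>; cutting \<open>g\<close> down to it leaves an arc that meets
    \<open>p\<close> in its ends only.\<close>
  define P where "P = {t\<in>{0..1}. g t \<in> path_image p}"
  have "P = {0..1} \<inter> g -` path_image p" by (auto simp: P_def)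
  then have "closed P"
    using continuous_closed_preimage[OF cg closed_atLeastAtMost closed_path_image] assms arc_imp_path by metis
  moreover have "bounded P" by (rule bounded_subset[of "{0..1}"]) (auto simp: P_def)
  ultimately have "compact P" by (simp add: compact_eq_bounded_closed)
  have P01: "0 \<in> P" "1 \<in> P" using assms(3,4) pathstart_in_path_image[of p] pathfinish_in_path_image[of p] unfolding P_def pathstart_def pathfinish_def by auto
  have t0P: "t0 \<notin> P" using t0 z by (auto simp: P_def)
  have "compact (P \<inter> {0..t0})" "compact (P \<inter> {t0..1})" using \<open>compact P\<close> by (auto intro: compact_Int)
  moreover have "P \<inter> {0..t0} \<noteq> {}" "P \<inter> {t0..1} \<noteq> {}" using P01 t0 by auto
  ultimately obtain a b where a: "a \<in> P \<inter> {0..t0}" "\<And>t. t \<in> P \<inter> {0..t0} \<Longrightarrow> t \<le> a"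
    and b: "b \<in> P \<inter> {t0..1}" "\<And>t. t \<in> P \<inter> {t0..1} \<Longrightarrow> b \<le> t"
    by (metis compact_attains_inf compact_attains_sup)
  have at: "a < t0" "t0 < b" using a b t0P by (auto simp: less_le)
  have out: "g t \<notin> path_image p" if "a < t" "t < b" for t
    using a(2)[of t] b(2)[of t] that t0 a(1) b(1) by (auto simp: P_def) (metis linear not_less order_trans)
  obtain c d where c: "c \<in> {0..1}" "p c = g a" and d: "d \<in> {0..1}" "p d = g b"
    using a b by (auto simp: P_def path_image_def)
  have cd: "c \<noteq> d" using c d inj_onD[OF ig, of a b] a(1) b(1) at by (auto simp: P_def)
  \<comment> \<open>Affine maps from \<open>[-1,1]\<close> to the parameter intervals;
    \<open>v\<close> may reverse orientation, since \<open>c < d\<close> is not known.\<close>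
  define u where "u x = a + (b - a) * ((1 + x) / 2)" for x :: real
  define v where "v x = c + (d - c) * ((1 + x) / 2)" for x :: real
  have ub: "u x \<in> {a..b}" if "x \<in> {-1..1}" for x
  proof -
    have "0 \<le> (b - a) * ((1 + x) / 2)" using that at by (intro mult_nonneg_nonneg) auto
    moreover have "(b - a) * ((1 + x) / 2) \<le> (b - a) * 1" using that at by (intro mult_left_mono) auto
    ultimately show ?thesis by (auto simp: u_def)
  qed
  have us: "u x \<in> {0..1}" if "x \<in> {-1..1}" for x using ub[OF that] a b by auto
  have vs: "v x \<in> {0..1}" if "x \<in> {-1..1}" for x
  proof -
    have "v x = (1 - (1 + x) / 2) * c + ((1 + x) / 2) * d" by (simp add: v_def field_simps)
    moreover have "\<dots> \<in> {0..1}" using convexD[OF convex_real_interval(5)[of 0 1], of c d "1 - (1 + x) / 2" "(1 + x) / 2"] c d that by simp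
    ultimately show ?thesis by simp
  qed
  have uinj: "u x = u y \<longleftrightarrow> x = y" and vinj: "v x = v y \<longleftrightarrow> x = y" for x y using at cd by (auto simp: u_def v_def)
  have ends: "u 1 = b" "u (-1) = a" "v 1 = d" "v (-1) = c" by (auto simp: u_def v_def)
  let ?C = "sphere (0::complex) 1"
  have sq: "(Re w)\<^sup>2 + (Im w)\<^sup>2 = 1" if "w \<in> ?C" for w using that by (simp add: norm_complex_def)
  have Re: "Re w \<in> {-1..1}" if "w \<in> ?C" for w using abs_Re_le_cmod[of w] that by (auto simp: abs_le_iff)
  define h where "h w = (if Im w \<ge> 0 then g (u (Re w)) else p (v (Re w)))" for w
  have "continuous_on ({w \<in> ?C. Im w \<ge> 0} \<union> {w \<in> ?C. Im w \<le> 0}) h"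
    unfolding h_def
  proof (rule continuous_on_If)
    show "closed {w \<in> ?C. 0 \<le> Im w}" "closed {w \<in> ?C. Im w \<le> 0}"
      by (auto simp: Collect_conj_eq intro!: closed_Int closed_Collect_le closed_Collect_eq continuous_intros)
    show "continuous_on {w \<in> ?C. 0 \<le> Im w} (\<lambda>w. g (u (Re w)))"
      by (rule continuous_on_compose2[OF cg]) (use us Re in \<open>auto simp: u_def intro!: continuous_intros\<close>)
    show "continuous_on {w \<in> ?C. Im w \<le> 0} (\<lambda>w. p (v (Re w)))"
      by (rule continuous_on_compose2[OF cp]) (use vs Re in \<open>auto simp: v_def intro!: continuous_intros\<close>)
  next
    fix w assume "w \<in> {w \<in> ?C. 0 \<le> Im w}" "\<not> 0 \<le> Im w"
    then show "g (u (Re w)) = p (v (Re w))" by simp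
  next
    fix w assume w: "w \<in> {w \<in> ?C. Im w \<le> 0}" "0 \<le> Im w"
    then have "Im w = 0" by auto
    then have "Re w = 1 \<or> Re w = -1" using sq[of w] w by (simp add: power2_eq_1_iff)
    then show "g (u (Re w)) = p (v (Re w))" using ends c d by auto
  qed
  moreover have "{w \<in> ?C. Im w \<ge> 0} \<union> {w \<in> ?C. Im w \<le> 0} = ?C" by auto
  ultimately have ch: "continuous_on ?C h" by simp
  \<comment> \<open>A common value of the two halves is an end of the cut arc, which forces
    \<open>Re w'\<close> to be 1 or -1; this is impossible on the open lower half.\<close>
  have mixed: False if w: "w \<in> ?C" "w' \<in> ?C" "Im w \<ge> 0" "Im w' < 0" "g (u (Re w)) = p (v (Re w'))" for w w'
  proof -
    have "g (u (Re w)) \<in> path_image p" using w(5) vs[OF Re[OF w(2)]] by (auto simp: path_image_def)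
    then have "u (Re w) = a \<or> u (Re w) = b" using out[of "u (Re w)"] ub[OF Re[OF w(1)]] by (auto simp: le_less)
    then have "p (v (Re w')) = p c \<or> p (v (Re w')) = p d" using w(5) c d by metis
    then have "v (Re w') = v (-1) \<or> v (Re w') = v 1"
      using ends inj_onD[OF ip] vs[OF Re[OF w(2)]] c(1) d(1) by metis
    then have "Re w' = -1 \<or> Re w' = 1" unfolding vinj .
    then show False using sq[OF w(2)] w(4) by auto
  qed
  have "inj_on h ?C"
  proof (rule inj_onI)
    fix w w' assume w: "w \<in> ?C" "w' \<in> ?C" "h w = h w'"
    have ueq: "Re w = Re w'" if "g (u (Re w)) = g (u (Re w'))"
      using inj_onD[OF ig that us[OF Re[OF w(1)]] us[OF Re[OF w(2)]]] uinj by blast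
    have veq: "Re w = Re w'" if "p (v (Re w)) = p (v (Re w'))"
      using inj_onD[OF ip that vs[OF Re[OF w(1)]] vs[OF Re[OF w(2)]]] vinj by blast
    have im: "Im w = Im w' \<or> Im w = - Im w'" if "Re w = Re w'"
      using sq[OF w(1)] sq[OF w(2)] that power2_eq_iff[of "Im w" "Im w'"] by simp
    show "w = w'"
    proof (cases "Im w \<ge> 0"; cases "Im w' \<ge> 0")
      assume "Im w \<ge> 0" "Im w' \<ge> 0"
      then show ?thesis using w ueq im by (auto simp: h_def complex_eq_iff)
    next
      assume "Im w \<ge> 0" "\<not> Im w' \<ge> 0"
      then show ?thesis using w mixed[of w w'] by (auto simp: h_def)
    next
      assume "\<not> Im w \<ge> 0" "Im w' \<ge> 0"
      then show ?thesis using w mixed[of w' w] by (auto simp: h_def)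
    next
      assume "\<not> Im w \<ge> 0" "\<not> Im w' \<ge> 0"
      then show ?thesis using w veq im by (auto simp: h_def complex_eq_iff)
    qed
  qed
  then have "?C homeomorphic h ` ?C"
    using homeomorphic_compact[OF compact_sphere ch refl] by simp
  moreover have "h ` ?C \<subseteq> path_image g \<union> path_image p"
    using us vs Re by (auto simp: h_def path_image_def)
  ultimately show ?thesis using homeomorphic_sym by blast
qed

text \<open>Path components of \<open>S - {z}\<close> are relatively open, because a short path
  inside the ball of radius \<open>dist p z\<close> around \<open>p\<close> avoids \<open>z\<close>.
  If both ends of \<open>g\<close> lay in one of them, an arc extracted from a connecting path would
  close up with \<open>g\<close> to a circle.\<close>

lemma arc_point_separates:
  fixes S :: "'b::{complete_space,real_normed_vector} set"
  assumes "compact S"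
    and quasi: "locally_quasi_connected S"
    and no_circle: "\<And>C. C \<subseteq> S \<Longrightarrow> \<not> C homeomorphic sphere (0::complex) 1"
    and g: "arc g" "path_image g \<subseteq> S" "z \<in> path_image g" "z \<noteq> pathstart g" "z \<noteq> pathfinish g"
  shows "\<exists>A B. openin (top_of_set S) A \<and> openin (top_of_set S) B \<and> A \<inter> B = {} \<and> A \<union> B = S - {z} \<and>
    pathstart g \<in> A \<and> pathfinish g \<in> B"
proof -
  let ?x = "pathstart g" and ?y = "pathfinish g"
  have xS: "?x \<in> S" "?y \<in> S" using g by auto
  define A where "A = {p. path_component (S - {z}) ?x p}"
  have nbhd: "\<exists>\<delta>>0. \<forall>q\<in>S. dist p q < \<delta> \<longrightarrow> path_component (S - {z}) p q" if p: "p \<in> S - {z}" for p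
  proof -
    have "dist p z > 0" using p by auto
    from short_paths[OF assms(1) quasi this] obtain \<delta> where \<delta>: "\<delta> > 0" "\<And>q. q \<in> S \<Longrightarrow> dist p q < \<delta> \<Longrightarrow>
      \<exists>h. path h \<and> path_image h \<subseteq> S \<inter> ball p (dist p z) \<and> pathstart h = p \<and> pathfinish h = q"
      using p by blast
    have "path_component (S - {z}) p q" if q: "q \<in> S" "dist p q < \<delta>" for q
    proof -
      obtain h where "path h" "path_image h \<subseteq> S \<inter> ball p (dist p z)" "pathstart h = p" "pathfinish h = q"
        using \<delta>(2)[OF q] by blast
      moreover from this have "path_image h \<subseteq> S - {z}" by auto
      ultimately show ?thesis unfolding path_component_def by blast
    qed
    then show ?thesis using \<delta>(1) by blast
  qed
  have AS: "A \<subseteq> S - {z}" unfolding A_def using path_component_mem(2) by blast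
  have "openin (top_of_set S) A" unfolding openin_euclidean_subtopology_iff
  proof (intro conjI ballI)
    fix p assume p: "p \<in> A"
    then obtain \<delta> where "\<delta> > 0" and \<delta>: "\<And>q. q \<in> S \<Longrightarrow> dist p q < \<delta> \<Longrightarrow> path_component (S - {z}) p q"
      using nbhd[of p] AS by blast
    have "q \<in> A" if "q \<in> S" "dist q p < \<delta>" for q
      using \<delta>[of q] p that path_component_trans unfolding A_def by (metis dist_commute mem_Collect_eq)
    then show "\<exists>e>0. \<forall>x'\<in>S. dist x' p < e \<longrightarrow> x' \<in> A" using \<open>\<delta> > 0\<close> by blast
  qed (use AS in auto)
  moreover have "openin (top_of_set S) (S - {z} - A)" unfolding openin_euclidean_subtopology_iff
  proof (intro conjI ballI)
    fix p assume p: "p \<in> S - {z} - A"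
    then obtain \<delta> where "\<delta> > 0" and \<delta>: "\<And>q. q \<in> S \<Longrightarrow> dist p q < \<delta> \<Longrightarrow> path_component (S - {z}) p q"
      using nbhd[of p] by blast
    have "q \<in> S - {z} - A" if q: "q \<in> S" "dist q p < \<delta>" for q
    proof -
      have pq: "path_component (S - {z}) p q" using \<delta>[of q] q by (simp add: dist_commute)
      then have "q \<notin> A" using p path_component_trans path_component_sym unfolding A_def by blast
      then show ?thesis using path_component_mem(2)[OF pq] by blast
    qed
    then show "\<exists>e>0. \<forall>x'\<in>S. dist x' p < e \<longrightarrow> x' \<in> S - {z} - A" using \<open>\<delta> > 0\<close> by blast
  qed auto
  moreover have "?x \<in> A" unfolding A_def using xS g by (auto simp: path_component_refl_eq)
  moreover have "?y \<notin> A"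
  proof
    assume "?y \<in> A"
    then obtain h where h: "path h" "path_image h \<subseteq> S - {z}" "pathstart h = ?x" "pathfinish h = ?y"
      by (auto simp: A_def path_component_def)
    obtain p where p: "arc p" "path_image p \<subseteq> path_image h" "pathstart p = ?x" "pathfinish p = ?y"
      using path_contains_arc[OF h(1,3,4)] arc_distinct_ends[OF g(1)] by metis
    have "z \<notin> path_image p" using p h by auto
    then obtain C where "C \<subseteq> path_image g \<union> path_image p" "C homeomorphic sphere (0::complex) 1"
      using circle_of_two_arcs[OF g(1) p(1)] p g by metis
    then show False using no_circle[of C] p h g by blast
  qed
  ultimately show ?thesis using AS xS g by (intro exI[of _ A] exI[of _ "S - {z} - A"]) auto
qed

section \<open>Resistance forms\<close>

locale resistance_form_space =
  fixes E :: "('a \<Rightarrow> real) \<Rightarrow> ('a \<Rightarrow> real) \<Rightarrow> real" and F :: "('a \<Rightarrow> real) set"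
  assumes resistance_form: "resistance_form E F"
begin

abbreviation R where "R \<equiv> resistance_metric E F"

section \<open>Linear algebra of the form\<close>

lemma F_const [intro, simp]: "(\<lambda>_. c) \<in> F"
  and F_add [intro]: "u \<in> F \<Longrightarrow> v \<in> F \<Longrightarrow> (\<lambda>x. u x + v x) \<in> F"
  and F_scale [intro]: "u \<in> F \<Longrightarrow> (\<lambda>x. a * u x) \<in> F"
  and E_sym: "u \<in> F \<Longrightarrow> v \<in> F \<Longrightarrow> E u v = E v u"
  and E_nonneg [simp]: "u \<in> F \<Longrightarrow> 0 \<le> E u u"
  and E_eq_0_iff: "u \<in> F \<Longrightarrow> E u u = 0 \<longleftrightarrow> (\<exists>c. u = (\<lambda>_. c))"
  and separates: "x \<noteq> y \<Longrightarrow> \<exists>u\<in>F. u x \<noteq> u y"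
  and bdd_above_R: "bdd_above {\<bar>u x - u y\<bar>^2 | u. u \<in> F \<and> E u u \<le> 1}"
  and F_unit_contraction: "u \<in> F \<Longrightarrow> (\<lambda>x. min 1 (max 0 (u x))) \<in> F"
  and E_unit_contraction: "u \<in> F \<Longrightarrow> E (\<lambda>x. min 1 (max 0 (u x))) (\<lambda>x. min 1 (max 0 (u x))) \<le> E u u"
  using resistance_form unfolding resistance_form_def by simp_all

lemma E_add: "u \<in> F \<Longrightarrow> v \<in> F \<Longrightarrow> w \<in> F \<Longrightarrow> E (\<lambda>x. u x + v x) w = E u w + E v w"
  and E_scale: "u \<in> F \<Longrightarrow> v \<in> F \<Longrightarrow> E (\<lambda>x. a * u x) v = a * E u v"
proof -
  have "\<forall>u\<in>F. \<forall>v\<in>F. \<forall>w\<in>F. E (\<lambda>x. u x + v x) w = E u w + E v w"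
    "\<forall>u\<in>F. \<forall>v\<in>F. \<forall>a. E (\<lambda>x. a * u x) v = a * E u v"
    using resistance_form unfolding resistance_form_def by - (elim conjE, assumption)+
  then show "u \<in> F \<Longrightarrow> v \<in> F \<Longrightarrow> w \<in> F \<Longrightarrow> E (\<lambda>x. u x + v x) w = E u w + E v w"
    "u \<in> F \<Longrightarrow> v \<in> F \<Longrightarrow> E (\<lambda>x. a * u x) v = a * E u v" by blast+
qed

lemma F_complete:
  assumes "\<And>n. s n \<in> F"
    and "\<And>e. e > 0 \<Longrightarrow> \<exists>N. \<forall>n\<ge>N. \<forall>k\<ge>N. E (\<lambda>x. s n x - s k x) (\<lambda>x. s n x - s k x) < e"
  shows "\<exists>u\<in>F. (\<lambda>n. E (\<lambda>x. s n x - u x) (\<lambda>x. s n x - u x)) \<longlonglongrightarrow> 0"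
proof -
  have "\<forall>s. (\<forall>n. s n \<in> F) \<longrightarrow>
          (\<forall>e>0. \<exists>N. \<forall>n\<ge>N. \<forall>k\<ge>N. E (\<lambda>x. s n x - s k x) (\<lambda>x. s n x - s k x) < e) \<longrightarrow>
          (\<exists>u\<in>F. (\<lambda>n. E (\<lambda>x. s n x - u x) (\<lambda>x. s n x - u x)) \<longlonglongrightarrow> 0)"
    using resistance_form unfolding resistance_form_def by (elim conjE)
  then show ?thesis using assms by blast
qed

lemma F_minus [intro]: "u \<in> F \<Longrightarrow> (\<lambda>x. - u x) \<in> F"
  using F_scale[of u "-1"] by simp

lemma F_diff [intro]: "u \<in> F \<Longrightarrow> v \<in> F \<Longrightarrow> (\<lambda>x. u x - v x) \<in> F"
  using F_add[OF _ F_minus[of v], of u] by simp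

lemma F_divide [intro]: "u \<in> F \<Longrightarrow> (\<lambda>x. u x / c) \<in> F"
  using F_scale[of u "inverse c"] by (simp add: field_simps)

lemma F_sum: "(\<And>i. i \<in> I \<Longrightarrow> s i \<in> F) \<Longrightarrow> (\<lambda>x. \<Sum>i\<in>I. s i x) \<in> F"
  by (induction I rule: infinite_finite_induct) auto

lemma E_add_right: "u \<in> F \<Longrightarrow> v \<in> F \<Longrightarrow> w \<in> F \<Longrightarrow> E w (\<lambda>x. u x + v x) = E w u + E w v"
  using E_add[of u v w] E_sym[of w] by (simp add: F_add)

lemma E_scale_right: "u \<in> F \<Longrightarrow> v \<in> F \<Longrightarrow> E v (\<lambda>x. a * u x) = a * E v u"
  using E_scale[of u v a] E_sym[of v] by (simp add: F_scale)

lemma E_diff: "u \<in> F \<Longrightarrow> v \<in> F \<Longrightarrow> w \<in> F \<Longrightarrow> E (\<lambda>x. u x - v x) w = E u w - E v w"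
  using E_add[OF _ F_scale[of v "-1"], of u w] E_scale[of v w "-1"] by simp

lemma E_diff_right: "u \<in> F \<Longrightarrow> v \<in> F \<Longrightarrow> w \<in> F \<Longrightarrow> E w (\<lambda>x. u x - v x) = E w u - E w v"
  using E_diff[of u v w] E_sym[of w] by (simp add: F_diff)

lemma E_sum:
  "(\<And>i. i \<in> I \<Longrightarrow> s i \<in> F) \<Longrightarrow> v \<in> F \<Longrightarrow> E (\<lambda>x. \<Sum>i\<in>I. s i x) v = (\<Sum>i\<in>I. E (s i) v)"
proof (induction I rule: infinite_finite_induct)
  case (insert i I)
  then show ?case by (simp add: E_add F_sum)
qed (use E_scale[OF F_const, of v 0 0] in auto)

lemma E_sum_right:
  "(\<And>i. i \<in> I \<Longrightarrow> s i \<in> F) \<Longrightarrow> v \<in> F \<Longrightarrow> E v (\<lambda>x. \<Sum>i\<in>I. s i x) = (\<Sum>i\<in>I. E v (s i))"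
  by (subst E_sym) (auto simp: E_sum F_sum intro!: sum.cong E_sym)

lemma E_square_add:
  "u \<in> F \<Longrightarrow> v \<in> F \<Longrightarrow> E (\<lambda>x. u x + v x) (\<lambda>x. u x + v x) = E u u + 2 * E u v + E v v"
  by (simp add: E_add E_add_right F_add E_sym[of v u])

lemma E_square_diff:
  "u \<in> F \<Longrightarrow> v \<in> F \<Longrightarrow> E (\<lambda>x. u x - v x) (\<lambda>x. u x - v x) = E u u - 2 * E u v + E v v"
  by (simp add: E_diff E_diff_right F_diff E_sym[of v u])

lemma E_square_scale: "u \<in> F \<Longrightarrow> E (\<lambda>x. a * u x) (\<lambda>x. a * u x) = a\<^sup>2 * E u u"
  by (simp add: E_scale E_scale_right F_scale power2_eq_square)

lemma E_cauchy_schwarz: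
  assumes "u \<in> F" "v \<in> F"
  shows "(E u v)\<^sup>2 \<le> E u u * E v v"
proof -
  have *: "0 \<le> E u u + 2 * t * E u v + t\<^sup>2 * E v v" for t
    using E_nonneg[OF F_add[OF assms(1) F_scale[OF assms(2)], of t]] assms
    by (simp add: E_square_add F_scale E_square_scale E_scale_right)
  show ?thesis
  proof (cases "E v v = 0")
    case True
    have "E u v = 0"
    proof (rule ccontr)
      assume "E u v \<noteq> 0"
      \<comment> \<open>With \<open>E v v = 0\<close> the expression is affine in \<open>t\<close>,
        and this \<open>t\<close> gives it the value -1.\<close>
      then show False using *[of "- (E u u + 1) / (2 * E u v)"] True by (simp add: field_simps)
    qed
    then show ?thesis using True by simp
  next
    case False
    then have "E v v > 0" using assms by (simp add: less_le)
    then show ?thesis using *[of "- E u v / E v v"] by (simp add: field_simps power2_eq_square)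
  qed
qed

lemma E_const [simp]: "v \<in> F \<Longrightarrow> E (\<lambda>_. c) v = 0" "v \<in> F \<Longrightarrow> E v (\<lambda>_. c) = 0"
proof -
  have "E (\<lambda>_. c) (\<lambda>_. c) = 0" by (subst E_eq_0_iff) auto
  then show "v \<in> F \<Longrightarrow> E (\<lambda>_. c) v = 0" using E_cauchy_schwarz[of "\<lambda>_. c" v] by simp
  then show "v \<in> F \<Longrightarrow> E v (\<lambda>_. c) = 0" by (simp add: E_sym)
qed

lemma sqrt_E_triangle:
  assumes "u \<in> F" "v \<in> F"
  shows "sqrt (E (\<lambda>x. u x + v x) (\<lambda>x. u x + v x)) \<le> sqrt (E u u) + sqrt (E v v)"
proof (rule real_le_lsqrt)
  have "E u v \<le> sqrt (E u u * E v v)" using E_cauchy_schwarz[OF assms] by (rule real_le_rsqrt)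
  then show "E (\<lambda>x. u x + v x) (\<lambda>x. u x + v x) \<le> (sqrt (E u u) + sqrt (E v v))\<^sup>2"
    using assms by (simp add: E_square_add power2_sum real_sqrt_mult)
qed (use assms in \<open>auto simp: F_add\<close>)

lemma E_square_diff_le:
  assumes "u \<in> F" "v \<in> F"
  shows "E (\<lambda>x. u x - v x) (\<lambda>x. u x - v x) \<le> 2 * E u u + 2 * E v v"
  using E_nonneg[OF F_add[OF assms]] assms by (simp add: E_square_add E_square_diff)

section \<open>Resistance metric, truncations and layers\<close>

lemma R_nonneg [simp]: "0 \<le> R x y"
proof -
  have "(0::real) \<in> {\<bar>u x - u y\<bar>^2 | u. u \<in> F \<and> E u u \<le> 1}"
    by (intro CollectI exI[of _ "\<lambda>_. 0"]) auto
  from cSup_upper[OF this bdd_above_R] show ?thesis by (simp add: resistance_metric_def)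
qed

text \<open>Normalisation to unit energy. This is the bridge from energy to values: functions in
  \<open>F\<close> are Hoelder continuous of exponent 1/2 for \<open>R\<close>, and convergence in
  energy controls differences of values.\<close>

lemma oscillation_le:
  assumes "u \<in> F"
  shows "(u x - u y)\<^sup>2 \<le> E u u * R x y"
proof (cases "E u u = 0")
  case True
  then show ?thesis using assms by (auto simp: E_eq_0_iff)
next
  case False
  then have pos: "E u u > 0" using assms by (simp add: less_le)
  define a where "a = 1 / sqrt (E u u)"
  have a2: "a\<^sup>2 * E u u = 1" using pos by (simp add: a_def power_divide)
  have "\<bar>a * u x - a * u y\<bar>^2 \<in> {\<bar>u x - u y\<bar>^2 | u. u \<in> F \<and> E u u \<le> 1}"
    using assms a2 by (intro CollectI exI[of _ "\<lambda>x. a * u x"]) (auto simp: E_square_scale)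
  from cSup_upper[OF this bdd_above_R] have "a\<^sup>2 * (u x - u y)\<^sup>2 \<le> R x y"
    by (simp add: resistance_metric_def flip: right_diff_distrib power_mult_distrib)
  then have "E u u * (a\<^sup>2 * (u x - u y)\<^sup>2) \<le> E u u * R x y" using pos by simp
  moreover have "E u u * (a\<^sup>2 * (u x - u y)\<^sup>2) = (a\<^sup>2 * E u u) * (u x - u y)\<^sup>2" by simp
  ultimately show ?thesis by (simp only: a2 mult_1)
qed

text \<open>The unit contraction conjugated with the affine map carrying \<open>[a,b]\<close> to
  \<open>[0,1]\<close>, which degenerates for \<open>a = b\<close>.\<close>

lemma clamp_in_F_and_E_le:
  assumes "u \<in> F" "a \<le> b"
  shows "(\<lambda>x. min b (max a (u x))) \<in> F \<and>
    E (\<lambda>x. min b (max a (u x))) (\<lambda>x. min b (max a (u x))) \<le> E u u"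
proof (cases "a = b")
  case True
  then have "(\<lambda>x. min b (max a (u x))) = (\<lambda>_. b)" by (auto simp: fun_eq_iff)
  then show ?thesis using assms by simp
next
  case False
  then have ab: "b - a > 0" using assms by simp
  define w where "w = (\<lambda>x. (u x - a) / (b - a))"
  have w: "w \<in> F" unfolding w_def using assms by (intro F_divide F_diff F_const)
  have u: "u = (\<lambda>x. (b - a) * w x + a)" using ab by (simp add: w_def)
  let ?w = "\<lambda>x. min 1 (max 0 (w x))"
  have eq: "(\<lambda>x. min b (max a (u x))) = (\<lambda>x. (b - a) * ?w x + a)"
  proof
    fix x
    show "min b (max a (u x)) = (b - a) * ?w x + a"
      using ab unfolding w_def by (auto simp: min_def max_def field_simps)
  qed
  have aff: "E (\<lambda>x. (b - a) * v x + a) (\<lambda>x. (b - a) * v x + a) = (b - a)\<^sup>2 * E v v" if "v \<in> F" for v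
    using that by (simp add: E_square_add F_scale E_square_scale)
  have "E u u = (b - a)\<^sup>2 * E w w" by (subst (1 2) u) (rule aff[OF w])
  then show ?thesis unfolding eq aff[OF F_unit_contraction[OF w]]
    using E_unit_contraction[OF w] F_unit_contraction[OF w] by (auto intro: mult_left_mono)
qed

lemmas F_clamp = clamp_in_F_and_E_le[THEN conjunct1]
lemmas E_clamp = clamp_in_F_and_E_le[THEN conjunct2]

text \<open>The layer of \<open>u\<close> between the levels \<open>a\<close> and \<open>b\<close>,
  moved down to start at 0. Layers over adjacent intervals add up to a truncation of
  \<open>u\<close>, up to a constant.\<close>

definition slice :: "real \<Rightarrow> real \<Rightarrow> ('a \<Rightarrow> real) \<Rightarrow> 'a \<Rightarrow> real" where
  "slice a b u x = min b (max a (u x)) - a"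

lemma F_slice: "u \<in> F \<Longrightarrow> a \<le> b \<Longrightarrow> slice a b u \<in> F"
  unfolding slice_def[abs_def] by (intro F_diff F_clamp F_const)

text \<open>Adding a multiple of the upper slice does not change the truncation at the top of the lower
  slice, so by the Markov property it cannot decrease the energy.\<close>

lemma E_slice_nonneg:
  assumes "u \<in> F" "a \<le> b" "b \<le> c" "c \<le> d"
  shows "0 \<le> E (slice a b u) (slice c d u)"
proof (rule ccontr)
  let ?v = "slice a b u" and ?w = "slice c d u"
  assume neg: "\<not> 0 \<le> E ?v ?w"
  have F: "?v \<in> F" "?w \<in> F" using assms by (auto intro: F_slice)
  have ineq: "0 \<le> 2 * t * E ?v ?w + t\<^sup>2 * E ?w ?w" if "t \<ge> 0" for t
  proof -
    have "(\<lambda>x. min (b - a) (max 0 (?v x + t * ?w x))) = ?v"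
    proof
      fix x
      have "0 \<le> ?w x" "0 \<le> ?v x" "?v x \<le> b - a" using assms by (auto simp: slice_def)
      moreover from this have "0 \<le> t * ?w x" using that by simp
      moreover have "?v x = b - a \<or> ?w x = 0" using assms by (auto simp: slice_def min_def max_def)
      ultimately show "min (b - a) (max 0 (?v x + t * ?w x)) = ?v x" by auto
    qed
    then have "E ?v ?v \<le> E (\<lambda>x. ?v x + t * ?w x) (\<lambda>x. ?v x + t * ?w x)"
      using E_clamp[OF F_add[OF F(1) F_scale[OF F(2), of t]], of 0 "b - a"] assms by simp
    then show ?thesis using F by (simp add: E_square_add F_scale E_square_scale E_scale_right)
  qed
  show False
  proof (cases "E ?w ?w = 0")
    case True then show ?thesis using ineq[of 1] neg by simp
  next
    case False
    then have pos: "E ?w ?w > 0" using F by (simp add: less_le)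
    have "- E ?v ?w / E ?w ?w \<ge> 0" using neg pos by (simp add: divide_nonpos_pos)
    from ineq[OF this] have "E ?v ?w * E ?v ?w \<le> 0" using pos by (simp add: field_simps power2_eq_square)
    then show ?thesis using neg by (simp add: mult_le_0_iff)
  qed
qed

lemma E_slice_nonneg': 
  assumes "u \<in> F" "a \<le> b" "b \<le> c" "c \<le> d"
  shows "0 \<le> E (slice c d u) (slice a b u)"
  using E_slice_nonneg[OF assms] E_sym F_slice assms by auto

text \<open>\<open>R\<close> is a supremum of squares, so the inequality is not that of a seminorm.
  A function \<open>u\<close> with \<open>u z \<le> u x\<close> is cut at the level of
  \<open>u y\<close> into two layers, one for the increment between \<open>y\<close> and
  \<open>z\<close>, one for that between \<open>x\<close> and \<open>y\<close>. Their mutual energy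
  is nonnegative, so their energies sum to at most 1, and Cauchy-Schwarz in the plane combines the
  two oscillation bounds.\<close>

lemma R_triangle: "R x z \<le> R x y + R y z"
proof -
  have main: "(u x - u z)\<^sup>2 \<le> R x y + R y z" if u: "u \<in> F" "E u u \<le> 1" "u z \<le> u x" for u x z
  proof -
    \<comment> \<open>The level \<open>u y\<close> may lie outside \<open>[u z, u x]\<close> and is
      clamped to it.\<close>
    define c where "c = min (u x) (max (u z) (u y))"
    have c: "u z \<le> c" "c \<le> u x" using u(3) by (auto simp: c_def)
    define v where "v = slice (u z) c u"
    define w where "w = slice c (u x) u"
    have F: "v \<in> F" "w \<in> F" using c u by (auto simp: v_def w_def intro: F_slice)
    have sum: "(\<lambda>t. min (u x) (max (u z) (u t)) - u z) = (\<lambda>t. v t + w t)"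
      using c unfolding v_def w_def slice_def by (auto simp: fun_eq_iff min_def max_def)
    have "E (\<lambda>t. v t + w t) (\<lambda>t. v t + w t) \<le> E u u"
    proof -
      have "E (\<lambda>t. min (u x) (max (u z) (u t)) - u z) (\<lambda>t. min (u x) (max (u z) (u t)) - u z) \<le> E u u"
        using u E_clamp[OF u(1,3)] F_clamp[OF u(1,3)] by (subst E_square_diff) auto
      then show ?thesis unfolding sum .
    qed
    moreover have "0 \<le> E v w" unfolding v_def w_def using u c by (intro E_slice_nonneg) auto
    ultimately have vw: "E v v + E w w \<le> 1" using F u by (simp add: E_square_add)
    have "v y - v z = c - u z" "w x - w y = u x - c"
      using c u(3) unfolding v_def w_def slice_def c_def by (auto simp: min_def max_def)
    then have v: "(c - u z)\<^sup>2 \<le> E v v * R y z" and w: "(u x - c)\<^sup>2 \<le> E w w * R x y"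
      using oscillation_le[OF F(1), of y z] oscillation_le[OF F(2), of x y] by auto
    define p q where "p = sqrt (E v v)" and "q = sqrt (E w w)"
    define r s where "r = sqrt (R y z)" and "s = sqrt (R x y)"
    have pos: "p \<ge> 0" "q \<ge> 0" "r \<ge> 0" "s \<ge> 0" using F by (auto simp: p_def q_def r_def s_def)
    have sq: "p\<^sup>2 = E v v" "q\<^sup>2 = E w w" "r\<^sup>2 = R y z" "s\<^sup>2 = R x y"
      using F by (auto simp: p_def q_def r_def s_def)
    have "c - u z \<le> p * r" using v sq pos by (metis power2_le_imp_le power_mult_distrib mult_nonneg_nonneg)
    moreover have "u x - c \<le> q * s" using w sq pos by (metis power2_le_imp_le power_mult_distrib mult_nonneg_nonneg)
    ultimately have "u x - u z \<le> p * r + q * s" by simp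
    then have "(u x - u z)\<^sup>2 \<le> (p * r + q * s)\<^sup>2" using u(3) by (intro power_mono) auto
    also have "\<dots> \<le> (p\<^sup>2 + q\<^sup>2) * (r\<^sup>2 + s\<^sup>2)"
      using zero_le_power2[of "p * s - q * r"] by (simp add: power2_eq_square algebra_simps)
    also have "\<dots> \<le> 1 * (r\<^sup>2 + s\<^sup>2)" using vw sq by (intro mult_right_mono) auto
    finally show ?thesis using sq by simp
  qed
  have swap: "R a b = R b a" for a b unfolding resistance_metric_def by (simp add: abs_minus_commute)
  have "\<bar>u x - u z\<bar>\<^sup>2 \<le> R x y + R y z" if "u \<in> F" "E u u \<le> 1" for u
  proof (cases "u z \<le> u x")
    case True then show ?thesis using main[OF that] by simp
  next
    case False
    then show ?thesis using main[OF that, of x z] swap[of x y] swap[of y z] by (simp add: power2_commute)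
  qed
  then show ?thesis unfolding resistance_metric_def[of E F x z]
    by (intro cSup_least) (auto intro!: exI[of _ "\<lambda>_. 0"])
qed

sublocale Metric_space UNIV R
proof
  show "R x y = R y x" for x y unfolding resistance_metric_def by (simp add: abs_minus_commute)
  show "R x y = 0 \<longleftrightarrow> x = y" for x y
  proof
    assume "R x y = 0"
    then show "x = y" using separates[of x y] oscillation_le[of _ x y] by force
  next
    assume "x = y"
    moreover have "{\<bar>u y - u y\<bar>^2 | u. u \<in> F \<and> E u u \<le> 1} = {0}" by (auto intro!: exI[of _ "\<lambda>_. 0"])
    ultimately show "R x y = 0" by (simp add: resistance_metric_def)
  qed
qed (auto simp: R_triangle)

text \<open>Near-minimisers of the energy over the shrinking sets \<open>C n\<close> form a Cauchy sequence by the
  parallelogram identity.\<close>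

lemma F_closure:
  assumes "G \<subseteq> F" and mid: "\<And>u w. u \<in> G \<Longrightarrow> w \<in> G \<Longrightarrow> (\<lambda>x. (u x + w x) / 2) \<in> G"
    and approx: "\<And>e. e > 0 \<Longrightarrow> \<exists>w\<in>G. (\<forall>x. \<bar>w x - v x\<bar> \<le> e) \<and> E w w \<le> K"
  shows "v \<in> F" "E v v \<le> K" "\<And>e. e > 0 \<Longrightarrow> \<exists>w\<in>G. E (\<lambda>x. w x - v x) (\<lambda>x. w x - v x) < e"
proof -
  \<comment> \<open>The infimum of the energy over \<open>C n\<close> increases with
    \<open>n\<close> and stays below \<open>K\<close>, hence converges.\<close>
  define C where "C n = {w\<in>G. \<forall>x. \<bar>w x - v x\<bar> \<le> 1 / real (Suc n)}" for n
  define I where "I n = (INF w\<in>C n. E w w)" for n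
  have CF: "w \<in> F" if "w \<in> C n" for w n using that assms(1) by (auto simp: C_def)
  have ne: "\<exists>w\<in>C n. E w w \<le> K" for n using approx[of "1 / real (Suc n)"] by (auto simp: C_def)
  have bd: "bdd_below ((\<lambda>w. E w w) ` C n)" for n by (rule bdd_belowI[of _ 0]) (auto simp: CF)
  have I_le: "I n \<le> E w w" if "w \<in> C n" for w n unfolding I_def using that bd by (intro cINF_lower)
  have IK: "I n \<le> K" for n using ne[of n] I_le by force
  have Cmono: "C n \<subseteq> C k" if "k \<le> n" for k n
  proof -
    have "1 / real (Suc n) \<le> 1 / real (Suc k)" using that by (simp add: frac_le)
    then show ?thesis unfolding C_def using order_trans by blast
  qed
  have Imono: "incseq I" unfolding incseq_def
  proof (intro allI impI)
    fix k n :: nat assume "k \<le> n"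
    have "C n \<noteq> {}" using ne[of n] by blast
    then show "I k \<le> I n" unfolding I_def[of n]
      using I_le Cmono[OF \<open>k \<le> n\<close>] by (intro cINF_greatest) auto
  qed
  then obtain L where L: "I \<longlonglongrightarrow> L" "\<And>n. I n \<le> L" using IK incseq_convergent[of I K] by blast
  have "\<exists>w\<in>C n. E w w < I n + 1 / real (Suc n)" for n
  proof -
    have "I n < I n + 1 / real (Suc n)" by simp
    then show ?thesis unfolding I_def using ne[of n] bd[of n] by (subst (asm) cINF_less_iff) auto
  qed
  then obtain w where wC: "\<And>n. w n \<in> C n" and wE: "\<And>n. E (w n) (w n) < I n + 1 / real (Suc n)" by metis
  have wF: "w n \<in> F" for n using wC CF by blast
  \<comment> \<open>Midpoints stay in \<open>C N\<close> and so have energy at least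
    \<open>I N\<close>, while both near-minimisers have energy below
    \<open>L + 1 / real (Suc N)\<close>.\<close>
  have CauchyE: "E (\<lambda>x. w n x - w k x) (\<lambda>x. w n x - w k x) \<le> 4 * (L - I N) + 4 / real (Suc N)" if "n \<ge> N" "k \<ge> N" for n k N
  proof -
    have wN: "w n \<in> C N" "w k \<in> C N" using Cmono that wC by blast+
    have "\<bar>(w n x + w k x) / 2 - v x\<bar> \<le> 1 / real (Suc N)" for x
    proof -
      have "\<bar>w n x - v x\<bar> \<le> 1 / real (Suc N)" "\<bar>w k x - v x\<bar> \<le> 1 / real (Suc N)"
        using wN by (auto simp: C_def)
      moreover have "\<bar>(a + b) / 2 - c\<bar> \<le> e" if "\<bar>a - c\<bar> \<le> e" "\<bar>b - c\<bar> \<le> e" for a b c e :: real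
        using that by (auto simp: abs_le_iff field_simps)
      ultimately show ?thesis by blast
    qed
    then have "(\<lambda>x. (w n x + w k x) / 2) \<in> C N" using wN mid by (auto simp: C_def)
    from I_le[OF this] have "I N \<le> E (\<lambda>x. (1/2) * (w n x + w k x)) (\<lambda>x. (1/2) * (w n x + w k x))" by simp
    then have "4 * I N \<le> E (\<lambda>x. w n x + w k x) (\<lambda>x. w n x + w k x)"
      using E_square_scale[OF F_add[OF wF[of n] wF[of k]], of "1/2"] by (simp add: power2_eq_square)
    moreover have "1 / real (Suc n) \<le> 1 / real (Suc N)" "1 / real (Suc k) \<le> 1 / real (Suc N)" using that by (simp_all add: frac_le)
    ultimately show ?thesis using wE[of n] wE[of k] L(2)[of n] L(2)[of k] wF[of n] wF[of k] by (simp add: E_square_add E_square_diff)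
  qed
  have lim0: "(\<lambda>N. 4 * (L - I N) + 4 / real (Suc N)) \<longlonglongrightarrow> 0"
  proof -
    have "(\<lambda>N. 4 * (L - I N) + 4 * inverse (real (Suc N))) \<longlonglongrightarrow> 4 * (L - L) + 4 * 0"
      by (intro tendsto_intros L(1) LIMSEQ_inverse_real_of_nat)
    then show ?thesis by (simp add: divide_inverse)
  qed
  have "\<exists>N. \<forall>n\<ge>N. \<forall>k\<ge>N. E (\<lambda>x. w n x - w k x) (\<lambda>x. w n x - w k x) < e" if "e > 0" for e
  proof -
    have "\<forall>\<^sub>F N in sequentially. 4 * (L - I N) + 4 / real (Suc N) < e" using order_tendstoD(2)[OF lim0 that] .
    then obtain N where "4 * (L - I N) + 4 / real (Suc N) < e" by (meson eventually_sequentially order_refl)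
    then show ?thesis using CauchyE by (meson le_less_trans)
  qed
  from F_complete[OF wF this] obtain u where u: "u \<in> F" and ulim: "(\<lambda>n. E (\<lambda>x. w n x - u x) (\<lambda>x. w n x - u x)) \<longlonglongrightarrow> 0" by blast
  have ptw: "(\<lambda>n. w n x) \<longlonglongrightarrow> v x" for x
  proof -
    have "(\<lambda>n. w n x - v x) \<longlonglongrightarrow> 0"
      by (rule Lim_null_comparison[OF _ LIMSEQ_inverse_real_of_nat]) (use wC in \<open>auto simp: C_def divide_inverse\<close>)
    then show ?thesis by (simp add: LIM_zero_iff)
  qed
  \<comment> \<open>Completeness holds modulo constants, so the energy limit \<open>u\<close> and
    the pointwise limit \<open>v\<close> agree only up to an additive constant.\<close>
  have eqc: "v x - u x = v y - u y" for x y
  proof -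
    have "(\<lambda>n. ((w n x - u x) - (w n y - u y))\<^sup>2) \<longlonglongrightarrow> 0"
    proof (rule tendsto_sandwich[OF _ _ tendsto_const])
      show "\<forall>\<^sub>F n in sequentially. ((w n x - u x) - (w n y - u y))\<^sup>2 \<le> E (\<lambda>x. w n x - u x) (\<lambda>x. w n x - u x) * R x y"
        using oscillation_le[OF F_diff[OF wF u]] by auto
      show "(\<lambda>n. E (\<lambda>x. w n x - u x) (\<lambda>x. w n x - u x) * R x y) \<longlonglongrightarrow> 0"
        using tendsto_mult_right[OF ulim, of "R x y"] by simp
    qed auto
    moreover have "(\<lambda>n. ((w n x - u x) - (w n y - u y))\<^sup>2) \<longlonglongrightarrow> ((v x - u x) - (v y - u y))\<^sup>2"
      by (intro tendsto_intros ptw)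
    ultimately have "((v x - u x) - (v y - u y))\<^sup>2 = 0" using LIMSEQ_unique by blast
    then show ?thesis by simp
  qed
  obtain c where c: "v = (\<lambda>x. u x + c)"
  proof
    show "v = (\<lambda>x. u x + (v undefined - u undefined))" using eqc[of _ undefined] by (auto simp: fun_eq_iff algebra_simps)
  qed
  show vF: "v \<in> F" unfolding c using u by auto
  have same: "E (\<lambda>x. w n x - v x) (\<lambda>x. w n x - v x) = E (\<lambda>x. w n x - u x) (\<lambda>x. w n x - u x)" for n
    using u wF by (simp add: c E_square_diff E_square_add E_add_right F_add)
  then have vlim: "(\<lambda>n. E (\<lambda>x. w n x - v x) (\<lambda>x. w n x - v x)) \<longlonglongrightarrow> 0" using ulim by simp
  show "\<exists>w\<in>G. E (\<lambda>x. w x - v x) (\<lambda>x. w x - v x) < e" if "e > 0" for e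
  proof -
    have "\<forall>\<^sub>F n in sequentially. E (\<lambda>x. w n x - v x) (\<lambda>x. w n x - v x) < e" using order_tendstoD(2)[OF vlim that] .
    then obtain N where "E (\<lambda>x. w N x - v x) (\<lambda>x. w N x - v x) < e" by (meson eventually_sequentially order_refl)
    then show ?thesis using wC[of N] by (auto simp: C_def)
  qed
  have "sqrt (E v v) \<le> sqrt K"
  proof (rule LIMSEQ_le_const)
    show "(\<lambda>n. sqrt (K + inverse (real (Suc n))) + sqrt (E (\<lambda>x. w n x - v x) (\<lambda>x. w n x - v x))) \<longlonglongrightarrow> sqrt K"
      using tendsto_add[OF tendsto_real_sqrt[OF tendsto_add[OF tendsto_const[of K] LIMSEQ_inverse_real_of_nat]] tendsto_real_sqrt[OF vlim]] by simp
    have "sqrt (E v v) \<le> sqrt (K + inverse (real (Suc n))) + sqrt (E (\<lambda>x. w n x - v x) (\<lambda>x. w n x - v x))" for n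
    proof -
      have "sqrt (E v v) \<le> sqrt (E (w n) (w n)) + sqrt (E (\<lambda>x. v x - w n x) (\<lambda>x. v x - w n x))"
        using sqrt_E_triangle[OF wF[of n] F_diff[OF vF wF[of n]]] by simp
      moreover have "sqrt (E (\<lambda>x. v x - w n x) (\<lambda>x. v x - w n x)) = sqrt (E (\<lambda>x. w n x - v x) (\<lambda>x. w n x - v x))"
        using E_square_diff[OF vF wF] E_square_diff[OF wF vF] E_sym[OF vF wF, of n] by simp
      moreover have "sqrt (E (w n) (w n)) \<le> sqrt (K + inverse (real (Suc n)))"
        using wE[of n] IK[of n] by (simp add: divide_inverse)
      ultimately show ?thesis by linarith
    qed
    then show "\<exists>N. \<forall>n\<ge>N. sqrt (E v v) \<le> sqrt (K + inverse (real (Suc n))) + sqrt (E (\<lambda>x. w n x - v x) (\<lambda>x. w n x - v x))" by blast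
  qed
  then show "E v v \<le> K" by simp
qed

section \<open>Products of functions in \<open>F\<close>\<close>

lemma E_weighted_sum_le:
  assumes s: "\<And>i. i \<in> I \<Longrightarrow> s i \<in> F" and pos: "\<And>i j. i \<in> I \<Longrightarrow> j \<in> I \<Longrightarrow> 0 \<le> E (s i) (s j)"
    and a: "\<And>i. i \<in> I \<Longrightarrow> \<bar>a i\<bar> \<le> L"
  shows "E (\<lambda>x. \<Sum>i\<in>I. a i * s i x) (\<lambda>x. \<Sum>i\<in>I. a i * s i x) \<le> L\<^sup>2 * E (\<lambda>x. \<Sum>i\<in>I. s i x) (\<lambda>x. \<Sum>i\<in>I. s i x)"
proof -
  have "E (\<lambda>x. \<Sum>i\<in>I. a i * s i x) (\<lambda>x. \<Sum>i\<in>I. a i * s i x) = (\<Sum>i\<in>I. \<Sum>j\<in>I. a i * a j * E (s i) (s j))"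
    using s by (simp add: E_sum E_sum_right F_sum F_scale E_scale E_scale_right sum_distrib_left mult.assoc)
  \<comment> \<open>Nonnegative mutual energies reduce this to a comparison of weights, term by
    term.\<close>
  also have "\<dots> \<le> (\<Sum>i\<in>I. \<Sum>j\<in>I. L\<^sup>2 * E (s i) (s j))"
  proof (intro sum_mono mult_right_mono pos)
    fix i j assume ij: "i \<in> I" "j \<in> I"
    have "a i * a j \<le> \<bar>a i\<bar> * \<bar>a j\<bar>" by (metis abs_ge_self abs_mult)
    also have "\<dots> \<le> L * L" using a[OF ij(1)] a[OF ij(2)] by (intro mult_mono) auto
    finally show "a i * a j \<le> L\<^sup>2" by (simp add: power2_eq_square)
  qed auto
  also have "\<dots> = L\<^sup>2 * E (\<lambda>x. \<Sum>i\<in>I. s i x) (\<lambda>x. \<Sum>i\<in>I. s i x)"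
    using s by (simp add: E_sum E_sum_right F_sum sum_distrib_left)
  finally show ?thesis .
qed

text \<open>The chord of the square function over \<open>[t i, t (Suc i)]\<close> has slope
  \<open>t i + t (Suc i)\<close>, so the weighted sum of layers is the piecewise linear
  interpolation at the nodes. Slices of a constant function give the pointwise form, applied with
  \<open>y = u x\<close>.\<close>

lemma square_interpolation:
  fixes y M :: real and n :: nat
  assumes "0 \<le> y" "y \<le> M" "0 < n"
  defines "t \<equiv> \<lambda>i. real i * M / real n"
  shows "(\<Sum>i<n. slice (t i) (t (Suc i)) (\<lambda>_. y) x) = y"
    and "\<bar>(\<Sum>i<n. (t i + t (Suc i)) * slice (t i) (t (Suc i)) (\<lambda>_. y) x) - y\<^sup>2\<bar> \<le> M\<^sup>2 / real n"
proof -
  define c where "c i = min y (t i)" for i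
  have tm: "t i \<le> t (Suc i)" "t (Suc i) = t i + M / real n" for i using assms unfolding t_def by (auto simp: field_simps)
  have sl: "slice (t i) (t (Suc i)) (\<lambda>_. y) x = c (Suc i) - c i" for i
    using tm(1)[of i] by (auto simp: slice_def c_def min_def max_def)
  have c0: "c 0 = 0" "c n = y" using assms by (auto simp: c_def t_def)
  show s: "(\<Sum>i<n. slice (t i) (t (Suc i)) (\<lambda>_. y) x) = y"
    unfolding sl using c0 by (simp add: sum_lessThan_telescope)
  have "y\<^sup>2 = (\<Sum>i<n. (c (Suc i))\<^sup>2 - (c i)\<^sup>2)" using c0 by (subst sum_lessThan_telescope) simp
  also have "\<dots> = (\<Sum>i<n. (c i + c (Suc i)) * (c (Suc i) - c i))"
    by (intro sum.cong) (auto simp: power2_eq_square algebra_simps)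
  finally have "(\<Sum>i<n. (t i + t (Suc i)) * (c (Suc i) - c i)) - y\<^sup>2
    = (\<Sum>i<n. (t i + t (Suc i) - c i - c (Suc i)) * (c (Suc i) - c i))"
    by (simp add: sum_subtractf[symmetric] algebra_simps)
  also have "\<bar>\<dots>\<bar> \<le> (\<Sum>i<n. M / real n * (c (Suc i) - c i))"
  proof (rule order_trans[OF sum_abs sum_mono])
    fix i
    \<comment> \<open>A layer that \<open>y\<close> does not enter contributes nothing; otherwise
      the lower node is attained and the defect is at most one mesh width.\<close>
    have "c (Suc i) = c i \<or> (c i = t i \<and> \<bar>t (Suc i) - c (Suc i)\<bar> \<le> M / real n \<and> c i \<le> c (Suc i))"
      using tm[of i] by (auto simp: c_def min_def)
    then consider "c (Suc i) = c i" | "c i = t i" "\<bar>t (Suc i) - c (Suc i)\<bar> \<le> M / real n" "c i \<le> c (Suc i)" by blast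
    then show "\<bar>(t i + t (Suc i) - c i - c (Suc i)) * (c (Suc i) - c i)\<bar> \<le> M / real n * (c (Suc i) - c i)"
    proof cases
      case 2
      have "\<bar>t (Suc i) - c (Suc i)\<bar> * (c (Suc i) - c i) \<le> M / real n * (c (Suc i) - c i)"
        using 2 by (intro mult_right_mono) auto
      then show ?thesis using 2 by (simp add: abs_mult)
    qed simp
  qed
  also have "\<dots> = M / real n * y" using s unfolding sl by (simp only: sum_distrib_left[symmetric])
  also have "\<dots> \<le> M / real n * M" using assms by (intro mult_left_mono) auto
  finally show "\<bar>(\<Sum>i<n. (t i + t (Suc i)) * slice (t i) (t (Suc i)) (\<lambda>_. y) x) - y\<^sup>2\<bar> \<le> M\<^sup>2 / real n"
    unfolding sl by (simp add: power2_eq_square)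
qed

text \<open>The interpolations have slopes at most \<open>2 * M\<close>, so their energies are
  bounded uniformly in the mesh, and they converge uniformly to the square.\<close>

lemma F_square_of_bounded_nonneg:
  assumes u: "u \<in> F" "\<And>x. 0 \<le> u x" "\<And>x. u x \<le> M"
  shows "(\<lambda>x. (u x)\<^sup>2) \<in> F"
proof (rule F_closure(1)[where G = F and K = "(2 * M)\<^sup>2 * E u u"])
  fix e :: real assume "e > 0"
  obtain n :: nat where n: "M\<^sup>2 / e < real n" "0 < n"
    using reals_Archimedean2[of "max (M\<^sup>2 / e) 0"] by (metis max_less_iff_conj of_nat_0_less_iff)
  have M0: "M \<ge> 0" using u(2,3) order_trans by blast
  define t where "t i = real i * M / real n" for i
  have tm: "t i \<le> t j" if "i \<le> j" for i j using that M0 unfolding t_def by (intro divide_right_mono mult_right_mono) auto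
  have t0M: "0 \<le> t i" "t i \<le> M" if "i \<le> n" for i
    using that M0 n unfolding t_def by (auto simp: divide_le_eq mult.commute[of M] intro: mult_right_mono)
  define s where "s i = slice (t i) (t (Suc i)) u" for i
  have sy: "s i x = slice (t i) (t (Suc i)) (\<lambda>_. u x) x" for i x by (simp add: s_def slice_def)
  let ?w = "\<lambda>x. \<Sum>i<n. (t i + t (Suc i)) * s i x"
  have sF: "s i \<in> F" for i unfolding s_def using u tm by (intro F_slice) auto
  have "0 \<le> E (s i) (s j)" for i j
  proof (cases i j rule: linorder_cases)
    case less then show ?thesis unfolding s_def using tm u by (intro E_slice_nonneg) auto
  next
    case equal then show ?thesis using sF by simp
  next
    case greater then show ?thesis unfolding s_def using tm u by (intro E_slice_nonneg') auto
  qed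
  moreover have "\<bar>t i + t (Suc i)\<bar> \<le> 2 * M" if "i \<in> {..<n}" for i
    using t0M[of i] t0M[of "Suc i"] that by simp
  ultimately have "E ?w ?w \<le> (2 * M)\<^sup>2 * E (\<lambda>x. \<Sum>i<n. s i x) (\<lambda>x. \<Sum>i<n. s i x)"
    using sF by (intro E_weighted_sum_le) auto
  moreover have "(\<lambda>x. \<Sum>i<n. s i x) = u"
    unfolding sy t_def using square_interpolation(1)[OF u(2,3) n(2)] by simp
  moreover have "\<bar>?w x - (u x)\<^sup>2\<bar> \<le> e" for x
  proof -
    have "M\<^sup>2 / real n \<le> e" using n \<open>e > 0\<close> by (simp add: field_simps)
    then show ?thesis using square_interpolation(2)[OF u(2,3) n(2)] unfolding sy t_def by (rule order_trans[rotated])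
  qed
  moreover have "?w \<in> F" using sF by (intro F_sum F_scale)
  ultimately show "\<exists>w\<in>F. (\<forall>x. \<bar>w x - (u x)\<^sup>2\<bar> \<le> e) \<and> E w w \<le> (2 * M)\<^sup>2 * E u u"
    by (intro bexI[of _ ?w]) simp_all
qed auto

lemma F_mult_of_bounded:
  assumes "u \<in> F" "v \<in> F" "\<And>x. \<bar>u x\<bar> \<le> M" "\<And>x. \<bar>v x\<bar> \<le> M"
  shows "(\<lambda>x. u x * v x) \<in> F"
proof -
  \<comment> \<open>Adding \<open>C\<close> makes \<open>w\<close> nonnegative; the product then
    follows by polarisation.\<close>
  have sq: "(\<lambda>x. (w x)\<^sup>2) \<in> F" if "w \<in> F" "\<And>x. \<bar>w x\<bar> \<le> C" for w C
  proof -
    have "0 \<le> w x + C" "w x + C \<le> 2 * C" for x using that(2)[of x] by (simp_all add: abs_le_iff)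
    then have "(\<lambda>x. (w x + C)\<^sup>2) \<in> F" using that by (intro F_square_of_bounded_nonneg[where M = "2 * C"]) auto
    then have "(\<lambda>x. (w x + C)\<^sup>2 - (2 * C) * w x - C\<^sup>2) \<in> F" using that by (intro F_diff F_scale F_const)
    then show ?thesis by (simp add: power2_sum algebra_simps)
  qed
  have "\<bar>u x + v x\<bar> \<le> 2 * M" for x using abs_triangle_ineq[of "u x" "v x"] assms(3,4)[of x] by simp
  then have "(\<lambda>x. ((u x + v x)\<^sup>2 - (u x)\<^sup>2 - (v x)\<^sup>2) / 2) \<in> F"
    using assms by (intro F_divide F_diff sq) auto
  then show ?thesis by (simp add: power2_sum)
qed

end

section \<open>Local resistance forms on compact spaces\<close>

locale local_resistance_form = resistance_form_space E F
  for E :: "('a \<Rightarrow> real) \<Rightarrow> ('a \<Rightarrow> real) \<Rightarrow> real" and F :: "('a \<Rightarrow> real) set" +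
  assumes strongly_local: "strongly_local (resistance_topology E F) E F"
    and compact_space: "compact_space (resistance_topology E F)"
begin

abbreviation T where "T \<equiv> resistance_topology E F"

lemma T_eq: "T = mtopology" by (simp add: resistance_topology_def)

lemma topspace_T [simp]: "topspace T = UNIV" by (simp add: T_eq)

lemma openin_T_iff: "openin T U \<longleftrightarrow> (\<forall>x\<in>U. \<exists>r>0. \<forall>y. R x y < r \<longrightarrow> y \<in> U)"
  by (auto simp: T_eq openin_mtopology mball_def subset_iff)

section \<open>Metric model of the space and separation of closed sets\<close>

lemma R_bounded: "\<exists>B. \<forall>x y. R x y \<le> B"
proof -
  have "compactin mtopology UNIV" using compact_space unfolding T_eq compact_space_def by simp
  then obtain a B where "UNIV \<subseteq> mcball a B" using compactin_imp_mbounded mbounded_def by metis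
  then have B: "R a x \<le> B" for x by auto
  have "R x y \<le> B + B" for x y using R_triangle[of x y a] B[of x] B[of y] commute[of a x] by linarith
  then show ?thesis by blast
qed

text \<open>The Kuratowski embedding into a Banach space makes the library on paths and arcs and the
  Stone--Weierstrass theorem applicable.\<close>

definition emb :: "'a \<Rightarrow> 'a discrete \<Rightarrow>\<^sub>C real" where
  "emb x = Bcontfun (\<lambda>y. R x (of_discrete y))"

text \<open>Continuity is automatic on the discrete type and boundedness comes from compactness, so
  the distance functions do lie in \<open>bcontfun\<close>.\<close>

lemma emb_apply: "apply_bcontfun (emb x) y = R x (of_discrete y)"
proof -
  obtain B where "\<And>x y. R x y \<le> B" using R_bounded by blast
  then have "(\<lambda>y. R x (of_discrete y)) \<in> bcontfun"
    by (intro bcontfun_normI) (auto simp: continuous_on_open_vimage open_discrete)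
  then show ?thesis by (simp add: emb_def Bcontfun_inverse)
qed

lemma dist_emb [simp]: "dist (emb x) (emb y) = R x y"
proof (rule antisym)
  show "dist (emb x) (emb y) \<le> R x y"
  proof (rule dist_bound)
    fix z :: "'a discrete"
    show "dist (apply_bcontfun (emb x) z) (apply_bcontfun (emb y) z) \<le> R x y"
      using R_triangle[of x "of_discrete z" y] R_triangle[of y "of_discrete z" x] commute[of x y]
      unfolding emb_apply dist_real_def by linarith
  qed
  show "R x y \<le> dist (emb x) (emb y)"
    using dist_bounded[of "emb x" "discrete y" "emb y"] by (simp add: emb_apply discrete_inverse dist_real_def)
qed

lemma emb_eq_iff [simp]: "emb x = emb y \<longleftrightarrow> x = y"
  by (metis dist_emb dist_eq_0_iff iso_tuple_UNIV_I zero)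

lemma inj_emb: "inj emb" by (simp add: inj_def)

lemma openin_emb_image: "openin (top_of_set (range emb)) (emb ` U) \<longleftrightarrow> openin T U"
proof -
  have "dist (emb y) (emb x) = R x y" for x y by (simp add: commute)
  then show ?thesis unfolding openin_T_iff openin_euclidean_subtopology_iff
    by (simp add: inj_image_mem_iff[OF inj_emb] image_mono del: dist_emb)
qed

lemma continuous_map_emb: "continuous_map T (top_of_set (range emb)) emb"
  unfolding continuous_map_def
proof (intro conjI allI impI)
  fix V assume "openin (top_of_set (range emb)) V"
  moreover from this have "emb ` {x \<in> topspace T. emb x \<in> V} = V" by (auto dest: openin_imp_subset)
  ultimately show "openin T {x \<in> topspace T. emb x \<in> V}" using openin_emb_image by metis
qed auto

lemma homeomorphic_map_emb: "homeomorphic_map T (top_of_set (range emb)) emb"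
proof (rule bijective_open_imp_homeomorphic_map[OF continuous_map_emb])
  show "open_map T (top_of_set (range emb)) emb" by (simp add: open_map_def openin_emb_image)
qed (auto simp: inj_emb)

lemma compact_emb_image: "closedin T P \<Longrightarrow> compact (emb ` P)"
proof -
  assume "closedin T P"
  then have "compactin T P" using compact_space closedin_compact_space by blast
  then have "compactin euclidean (emb ` P)"
    using image_compactin[OF _ continuous_map_emb[THEN continuous_map_into_fulltopology]] by blast
  then show ?thesis by simp
qed

lemma compact_range_emb: "compact (range emb)"
  using compact_emb_image[of UNIV] closedin_topspace[of T] by simp

lemma F_continuous:
  assumes "u \<in> F"
  shows "continuous_map T euclideanreal u"
  unfolding continuous_map_def
proof (intro conjI allI impI)
  fix U :: "real set" assume "openin euclideanreal U"
  then have "open U" by simp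
  show "openin T {x \<in> topspace T. u x \<in> U}" unfolding openin_T_iff
  proof
    fix x assume "x \<in> {x \<in> topspace T. u x \<in> U}"
    then obtain e where e: "e > 0" "\<And>t. dist t (u x) < e \<Longrightarrow> t \<in> U"
      using \<open>open U\<close> by (auto simp: open_dist)
    have pos: "1 + E u u > 0" using E_nonneg[OF assms] by linarith
    have "u y \<in> U" if y: "R x y < e\<^sup>2 / (1 + E u u)" for y
    proof -
      have "(u x - u y)\<^sup>2 \<le> E u u * R x y" by (rule oscillation_le[OF assms])
      also have "\<dots> \<le> (1 + E u u) * R x y" by (intro mult_right_mono) auto
      also have "\<dots> < e\<^sup>2" using y pos by (simp add: field_simps)
      finally have "\<bar>u x - u y\<bar>\<^sup>2 < e\<^sup>2" by simp
      then have "\<bar>u x - u y\<bar> < e" by (rule power2_less_imp_less) (use e(1) in simp)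
      then show ?thesis by (intro e(2)) (simp add: dist_real_def abs_minus_commute)
    qed
    then show "\<exists>r>0. \<forall>y. R x y < r \<longrightarrow> y \<in> {x \<in> topspace T. u x \<in> U}"
      using e(1) pos by (intro exI[of _ "e\<^sup>2 / (1 + E u u)"]) auto
  qed
qed auto

lemma F_bounded: "u \<in> F \<Longrightarrow> \<exists>M. \<forall>x. \<bar>u x\<bar> \<le> M"
proof -
  assume "u \<in> F"
  then have "compactin euclideanreal (u ` UNIV)"
    using image_compactin[OF _ F_continuous, of UNIV u] compact_space by (simp add: compact_space_def)
  then have "bounded (range u)" by (simp add: compact_imp_bounded)
  then show ?thesis by (auto simp: bounded_iff)
qed

lemma F_mult [intro]:
  assumes "u \<in> F" "v \<in> F"
  shows "(\<lambda>x. u x * v x) \<in> F"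
proof -
  obtain M N where "\<And>x. \<bar>u x\<bar> \<le> M" "\<And>x. \<bar>v x\<bar> \<le> N" using assms F_bounded by metis
  then show ?thesis using assms by (intro F_mult_of_bounded[where M = "max M N"]) (auto simp: le_max_iff_disj)
qed

lemma F_square [intro]: "u \<in> F \<Longrightarrow> (\<lambda>x. (u x)\<^sup>2) \<in> F"
  using F_mult[of u u] by (simp add: power2_eq_square)

lemma F_level_sets:
  assumes "u \<in> F"
  shows "closedin T {x. e \<le> \<bar>u x\<bar>}" "closedin T {x. \<bar>u x\<bar> \<le> e}" "openin T {x. \<bar>u x\<bar> < e}"
proof -
  have "closed {t::real. e \<le> \<bar>t\<bar>}" "closed {t::real. \<bar>t\<bar> \<le> e}" "open {t::real. \<bar>t\<bar> < e}"
    by (auto intro!: closed_Collect_le open_Collect_less continuous_intros)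
  then show "closedin T {x. e \<le> \<bar>u x\<bar>}" "closedin T {x. \<bar>u x\<bar> \<le> e}" "openin T {x. \<bar>u x\<bar> < e}"
    using closedin_continuous_map_preimage[OF F_continuous[OF assms], of "{t. e \<le> \<bar>t\<bar>}"]
      closedin_continuous_map_preimage[OF F_continuous[OF assms], of "{t. \<bar>t\<bar> \<le> e}"]
      openin_continuous_map_preimage[OF F_continuous[OF assms], of "{t. \<bar>t\<bar> < e}"] by auto
qed

text \<open>Transported to \<open>range emb\<close>, \<open>F\<close> is a separating algebra of
  continuous functions on a compact set. The Stone-Weierstrass argument yields values below 1/3 on
  \<open>P\<close> and above 2/3 on \<open>Q\<close>; the unit contraction of
  \<open>3 * f - 1\<close> makes them exact.\<close>

lemma F_urysohn:
  assumes "closedin T P" "closedin T Q" "P \<inter> Q = {}"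
  shows "\<exists>\<phi>\<in>F. (\<forall>x. 0 \<le> \<phi> x \<and> \<phi> x \<le> 1) \<and> (\<forall>x\<in>P. \<phi> x = 0) \<and> (\<forall>x\<in>Q. \<phi> x = 1)"
proof -
  define W where "W = {w. continuous_on (range emb) w \<and> (\<lambda>x. w (emb x)) \<in> F}"
  have cont: "continuous_on (range emb) (\<lambda>p. u (inv emb p))" if "u \<in> F" for u
  proof -
    have "homeomorphic_map (top_of_set (range emb)) T (inv emb)"
      using homeomorphic_map_emb homeomorphic_maps_map homeomorphic_map_maps inj_emb
      by (smt (verit, best) homeomorphic_map_eq homeomorphic_maps_def inv_f_f topspace_euclidean_subtopology rangeE topspace_T)
    then have "continuous_map (top_of_set (range emb)) euclideanreal (u \<circ> inv emb)"
      using F_continuous[OF that] continuous_map_compose homeomorphic_imp_continuous_map by blast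
    then show ?thesis by (simp add: o_def)
  qed
  interpret function_ring_on W "range emb"
  proof
    fix p q assume pq: "p \<in> range emb" "q \<in> range emb" "p \<noteq> q"
    then obtain x y where xy: "p = emb x" "q = emb y" "x \<noteq> y" by auto
    obtain u where u: "u \<in> F" "u x \<noteq> u y" using separates[OF xy(3)] by blast
    show "\<exists>f\<in>W. f p \<noteq> f q"
      using u cont[OF u(1)] xy by (intro bexI[of _ "\<lambda>p. u (inv emb p)"]) (auto simp: W_def inv_f_f[OF inj_emb])
  qed (auto simp: W_def compact_range_emb intro: continuous_intros)
  have "\<exists>f\<in>W. f ` range emb \<subseteq> {0..1} \<and> (\<forall>x\<in>emb ` P. f x < 1/3) \<and> (\<forall>x\<in>emb ` Q. f x > 1 - 1/3)"
    using assms by (intro two compact_imp_closed compact_emb_image) (auto simp: inj_image_mem_iff[OF inj_emb])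
  then obtain f where f: "(\<lambda>x. f (emb x)) \<in> F" "\<And>x. x \<in> P \<Longrightarrow> f (emb x) < 1/3" "\<And>x. x \<in> Q \<Longrightarrow> f (emb x) > 1 - 1/3"
    by (auto simp: W_def)
  let ?g = "\<lambda>x. min 1 (max 0 (3 * f (emb x) - 1))"
  have "?g \<in> F" using f(1) by (intro F_unit_contraction F_diff F_scale F_const)
  then show ?thesis using f(2,3) by (intro bexI[of _ ?g]) (force simp: min_def max_def)+
qed

section \<open>Soft thresholding and locality\<close>

definition trunc :: "real \<Rightarrow> ('a \<Rightarrow> real) \<Rightarrow> 'a \<Rightarrow> real" where
  "trunc e u x = u x - min e (max (- e) (u x))"

text \<open>Removing the values in \<open>[-e,e]\<close> puts the support of
  \<open>trunc e u\<close> into the closed set where \<open>e \<le> \<bar>u x\<bar>\<close>, hence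
  inside every open set off which \<open>u\<close> vanishes. The 4 arises from
  \<open>E_square_diff_le\<close>, as \<open>u\<close> and its clamp each contribute at most
  \<open>2 * E u u\<close>.\<close>

lemma trunc:
  assumes "u \<in> F" "e > 0"
  shows F_trunc: "trunc e u \<in> F" and E_trunc: "E (trunc e u) (trunc e u) \<le> 4 * E u u"
    and trunc_close: "\<bar>trunc e u x - u x\<bar> \<le> e" and trunc_eq_0: "\<bar>u x\<bar> \<le> e \<Longrightarrow> trunc e u x = 0"
proof -
  have c: "(\<lambda>x. min e (max (- e) (u x))) \<in> F" and
    le: "E (\<lambda>x. min e (max (- e) (u x))) (\<lambda>x. min e (max (- e) (u x))) \<le> E u u"
    using assms by (auto intro!: F_clamp E_clamp)
  show "trunc e u \<in> F" unfolding trunc_def[abs_def] using c assms by (intro F_diff)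
  show "E (trunc e u) (trunc e u) \<le> 4 * E u u"
    using E_square_diff_le[OF assms(1) c] le unfolding trunc_def[abs_def] by linarith
  show "\<bar>trunc e u x - u x\<bar> \<le> e" "\<bar>u x\<bar> \<le> e \<Longrightarrow> trunc e u x = 0"
    using assms by (auto simp: trunc_def min_def max_def)
qed

lemma E_eq_0_of_supports:
  assumes "u \<in> F" "v \<in> F" "openin T A" "fsupport T u \<subseteq> A" "\<And>x. x \<in> A \<Longrightarrow> v x = c"
  shows "E u v = 0"
proof -
  have "\<exists>U c. openin T U \<and> fsupport T u \<subseteq> U \<and> (\<forall>x\<in>U. v x = c)" using assms(3-5) by (intro exI[of _ A] exI[of _ c]) simp
  with strongly_local[unfolded strongly_local_def, THEN bspec, OF assms(1), THEN bspec, OF assms(2)]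
  show ?thesis by (rule mp)
qed

lemma fsupport_subset: "closedin T P \<Longrightarrow> (\<And>x. x \<notin> P \<Longrightarrow> u x = 0) \<Longrightarrow> fsupport T u \<subseteq> P"
  unfolding fsupport_def by (rule closure_of_minimal) auto

text \<open>\<open>u\<close> and \<open>v\<close> may both be nonzero arbitrarily near the boundary
  of \<open>A\<close>, where strong locality says nothing. It does apply to thresholds of
  \<open>u\<close>; hence functions of zero mutual energy with \<open>v\<close> approximate
  \<open>u\<close> in energy, and Cauchy-Schwarz passes to the limit.\<close>

lemma E_cross_eq_0:
  assumes u: "u \<in> F" and v: "v \<in> F" and A: "openin T A" "\<And>x. x \<notin> A \<Longrightarrow> u x = 0" "\<And>x. x \<in> A \<Longrightarrow> v x = 0"
  shows "E u v = 0"
proof -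
  let ?G = "{g \<in> F. E g v = 0}"
  have "\<exists>w\<in>?G. (\<forall>x. \<bar>w x - u x\<bar> \<le> e) \<and> E w w \<le> 4 * E u u" if "e > 0" for e
  proof (rule bexI[of _ "trunc e u"])
    have "fsupport T (trunc e u) \<subseteq> {x. e \<le> \<bar>u x\<bar>}"
      using F_level_sets(1)[OF u] trunc_eq_0[OF u that] by (intro fsupport_subset) auto
    also have "\<dots> \<subseteq> A" using A(2) that by force
    finally have "E (trunc e u) v = 0" using A u v that by (intro E_eq_0_of_supports[where c = 0]) (auto intro: F_trunc)
    then show "trunc e u \<in> ?G" using F_trunc[OF u that] by simp
  qed (use E_trunc[OF u that] trunc_close[OF u that] in auto)
  moreover have "(\<lambda>x. (g x + h x) / 2) \<in> ?G" if "g \<in> ?G" "h \<in> ?G" for g h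
    using that v E_scale[OF F_add[of g h] v, of "1/2"] by (auto simp: E_add)
  ultimately have approx: "\<And>e. e > 0 \<Longrightarrow> \<exists>g\<in>?G. E (\<lambda>x. g x - u x) (\<lambda>x. g x - u x) < e"
    using F_closure(3)[of ?G u "4 * E u u"] by blast
  show ?thesis
  proof (rule ccontr)
    assume ne: "E u v \<noteq> 0"
    have pos: "E v v + 1 > 0" using E_nonneg[OF v] by linarith
    \<comment> \<open>With this tolerance Cauchy-Schwarz contradicts itself; the added 1 covers
      \<open>E v v = 0\<close>.\<close>
    obtain g where g: "g \<in> F" "E g v = 0" "E (\<lambda>x. g x - u x) (\<lambda>x. g x - u x) < (E u v)\<^sup>2 / (E v v + 1)"
      using approx[of "(E u v)\<^sup>2 / (E v v + 1)"] ne pos by auto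
    have "(E u v)\<^sup>2 = (E (\<lambda>x. g x - u x) v)\<^sup>2" using g u v by (simp add: E_diff)
    also have "\<dots> \<le> E (\<lambda>x. g x - u x) (\<lambda>x. g x - u x) * E v v" using g u v by (intro E_cauchy_schwarz) auto
    also have "\<dots> \<le> E (\<lambda>x. g x - u x) (\<lambda>x. g x - u x) * (E v v + 1)" using g u by (intro mult_left_mono E_nonneg F_diff) auto
    also have "\<dots> < (E u v)\<^sup>2" using g(3) pos by (simp add: field_simps)
    finally show False by simp
  qed
qed

text \<open>\<open>A\<close> and \<open>B\<close> may touch, so in general no function of
  \<open>F\<close> is 1 on one and 0 on the other. After thresholding, the parts in \<open>A\<close>
  and in \<open>B\<close> are separated closed sets and a cutoff exists. The two parts have zero
  mutual energy, so the restriction costs no more than the threshold itself, uniformly in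
  \<open>e\<close>.\<close>

lemma F_restrict:
  assumes A: "openin T A" and B: "openin T B" and AB: "A \<inter> B = {}"
    and f: "f \<in> F" "\<And>x. x \<notin> A \<union> B \<Longrightarrow> f x = 0"
  shows "(\<lambda>x. if x \<in> A then f x else 0) \<in> F"
    and "E (\<lambda>x. if x \<in> A then f x else 0) (\<lambda>x. if x \<in> A then f x else 0) \<le> 4 * E f f"
proof -
  have "\<exists>w\<in>F. (\<forall>x. \<bar>w x - (if x \<in> A then f x else 0)\<bar> \<le> e) \<and> E w w \<le> 4 * E f f" if "e > 0" for e
  proof -
    let ?t = "trunc e f" and ?L = "{x. e \<le> \<bar>f x\<bar>}"
    let ?tA = "\<lambda>x. if x \<in> A then ?t x else 0" and ?tB = "\<lambda>x. if x \<in> B then ?t x else 0"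
    have LAB: "?L \<subseteq> A \<union> B" using f(2) that by force
    \<comment> \<open>Each part is the level set minus an open set, hence closed.\<close>
    have "?L \<inter> A = ?L - B" "?L \<inter> B = ?L - A" using LAB AB by auto
    then have "closedin T (?L \<inter> B)" "closedin T (?L \<inter> A)"
      using F_level_sets(1)[OF f(1)] A B closedin_diff by metis+
    from F_urysohn[OF this] AB obtain \<phi> where \<phi>: "\<phi> \<in> F" "\<And>x. x \<in> ?L \<inter> B \<Longrightarrow> \<phi> x = 0" "\<And>x. x \<in> ?L \<inter> A \<Longrightarrow> \<phi> x = 1"
      by blast
    have t0: "?t x = 0" if "x \<notin> ?L" for x using that trunc_eq_0[OF f(1) \<open>e > 0\<close>, of x] by auto
    have tF: "?t \<in> F" by (rule F_trunc[OF f(1) that])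
    have "(\<lambda>x. \<phi> x * ?t x) = ?tA" using \<phi>(2,3) t0 LAB AB by (auto simp: fun_eq_iff)
    then have tA: "?tA \<in> F" using F_mult[OF \<phi>(1) tF] by simp
    have "(\<lambda>x. (1 - \<phi> x) * ?t x) = ?tB" using \<phi>(2,3) t0 LAB AB by (auto simp: fun_eq_iff)
    then have tB: "?tB \<in> F" using F_mult[OF F_diff[OF F_const[of 1] \<phi>(1)] tF] by simp
    have "E ?tA ?tB = 0" using A AB by (intro E_cross_eq_0[OF tA tB]) auto
    moreover have "(\<lambda>x. ?tA x + ?tB x) = ?t" using t0 LAB AB by (auto simp: fun_eq_iff)
    ultimately have "E ?tA ?tA \<le> E ?t ?t" using E_square_add[OF tA tB] E_nonneg[OF tB] by simp
    then have "E ?tA ?tA \<le> 4 * E f f" using E_trunc[OF f(1) that] by linarith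
    moreover have "\<bar>?tA x - (if x \<in> A then f x else 0)\<bar> \<le> e" for x using trunc_close[OF f(1) that, of x] that by auto
    ultimately show ?thesis using tA by (intro bexI[of _ ?tA]) simp_all
  qed
  from F_closure(1,2)[OF order_refl F_divide[OF F_add] this]
  show "(\<lambda>x. if x \<in> A then f x else 0) \<in> F"
    "E (\<lambda>x. if x \<in> A then f x else 0) (\<lambda>x. if x \<in> A then f x else 0) \<le> 4 * E f f" by blast+
qed

text \<open>If \<open>h\<close> is a cutoff function of \<open>x\<close> in \<open>W\<close>, then its restriction to a relatively clopen subset
  \<open>V\<close> of \<open>W\<close> has comparable energy, so points outside \<open>V\<close> stay away from \<open>x\<close> uniformly in \<open>V\<close>.\<close>

lemma clopen_contains_ball:
  assumes W: "openin T W" "x \<in> W"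
  shows "\<exists>r>0. \<forall>V. V \<subseteq> W \<and> x \<in> V \<and> openin T V \<and> openin T (W - V) \<longrightarrow> (\<forall>y. R x y < r \<longrightarrow> y \<in> V)"
proof -
  have "closedin T (UNIV - W)" using W(1) by (metis closedin_diff closedin_topspace topspace_T)
  moreover have "closedin T {x}" by (simp add: T_eq Hausdorff_space_mtopology closedin_Hausdorff_sing_eq)
  ultimately obtain h where h: "h \<in> F" "\<And>y. y \<notin> W \<Longrightarrow> h y = 0" "h x = 1"
    using F_urysohn[of "UNIV - W" "{x}"] W(2) by auto
  \<comment> \<open>The 1 keeps the radius meaningful when \<open>h\<close> is constant, as can
    happen for \<open>W = UNIV\<close>.\<close>
  have pos: "1 + 4 * E h h > 0" using E_nonneg[OF h(1)] by linarith
  have "y \<in> V" if V: "V \<subseteq> W" "x \<in> V" "openin T V" "openin T (W - V)" and y: "R x y < 1 / (1 + 4 * E h h)" for V y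
  proof (rule ccontr)
    assume "y \<notin> V"
    let ?g = "\<lambda>x. if x \<in> V then h x else 0"
    have g: "?g \<in> F" "E ?g ?g \<le> 4 * E h h"
      using F_restrict[OF V(3,4) _ h(1)] h(2) V(1) by auto
    have "1 \<le> E ?g ?g * R x y" using oscillation_le[OF g(1), of x y] \<open>y \<notin> V\<close> V(2) h(3) by simp
    also have "\<dots> \<le> (1 + 4 * E h h) * R x y" using g(2) by (intro mult_right_mono) auto
    also have "\<dots> < 1" using y pos by (simp add: field_simps)
    finally show False by simp
  qed
  then show ?thesis using pos by (intro exI[of _ "1 / (1 + 4 * E h h)"]) auto
qed

lemma locally_quasi_connected_emb: "locally_quasi_connected (range emb)"
  unfolding locally_quasi_connected_def
proof (intro allI impI)
  fix W p assume W: "openin (top_of_set (range emb)) W" "p \<in> W"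
  obtain x where x: "p = emb x" using W(2) openin_imp_subset[OF W(1)] by auto
  have img: "emb ` (emb -` V) = V" if "V \<subseteq> W" for V using that openin_imp_subset[OF W(1)] by auto
  have "openin T (emb -` W)" "x \<in> emb -` W" using W x img[of W] openin_emb_image by (metis order_refl, simp)
  from clopen_contains_ball[OF this] obtain r where r: "r > 0"
    "\<forall>V. V \<subseteq> emb -` W \<and> x \<in> V \<and> openin T V \<and> openin T (emb -` W - V) \<longrightarrow> (\<forall>y. R x y < r \<longrightarrow> y \<in> V)"
    by (elim exE conjE)
  have "range emb \<inter> ball p r \<subseteq> V" if V: "V \<subseteq> W" "p \<in> V" "openin (top_of_set (range emb)) V" "openin (top_of_set (range emb)) (W - V)" for V
  proof -
    have "openin T (emb -` V)" using V img[of V] openin_emb_image by metis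
    moreover have "openin T (emb -` W - emb -` V)" using V(4) img[of "W - V"] openin_emb_image by (metis Diff_subset vimage_Diff)
    moreover have "emb -` V \<subseteq> emb -` W" "x \<in> emb -` V" using V(1,2) x by auto
    ultimately have "\<forall>y. R x y < r \<longrightarrow> y \<in> emb -` V" using r(2)[THEN spec, of "emb -` V"] by simp
    then show ?thesis using x by auto
  qed
  then show "\<exists>r>0. \<forall>V. V \<subseteq> W \<and> p \<in> V \<and> openin (top_of_set (range emb)) V \<and> openin (top_of_set (range emb)) (W - V) \<longrightarrow> range emb \<inter> ball p r \<subseteq> V"
    using r(1) by blast
qed

text \<open>A circle in the image would pull back along the homeomorphism to a circle in
  \<open>T\<close>, so the separation result for compact subsets of a Banach space applies to
  \<open>range emb\<close>.\<close>

lemma dendrite_arc_point_separates: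
  assumes "dendrite T" "arc_in T g x y" "z \<in> g ` {0..1}" "z \<noteq> x" "z \<noteq> y"
  shows "\<exists>A B. openin T A \<and> openin T B \<and> A \<inter> B = {} \<and> A \<union> B = UNIV - {z} \<and> x \<in> A \<and> y \<in> B"
proof -
  let ?g = "emb \<circ> g"
  have g: "continuous_map (top_of_set {0..1}) T g" "inj_on g {0..1}" "g 0 = x" "g 1 = y"
    using assms(2) by (auto simp: arc_in_def)
  have "continuous_map (top_of_set {0..1}) euclidean ?g"
    using continuous_map_compose[OF g(1) continuous_map_into_fulltopology[OF continuous_map_emb]] .
  then have "arc ?g" unfolding arc_def path_def using g(2) by (auto intro: comp_inj_on inj_on_subset[OF inj_emb])
  moreover have "pathstart ?g = emb x" "pathfinish ?g = emb y" using g by (auto simp: pathstart_def pathfinish_def)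
  moreover have "\<not> C homeomorphic sphere (0::complex) 1" if C: "C \<subseteq> range emb" for C
  proof
    assume "C homeomorphic sphere (0::complex) 1"
    then obtain h k where "homeomorphism C (sphere (0::complex) 1) h k" by (auto simp: homeomorphic_def)
    then have "homeomorphic_maps (top_of_set C) (top_of_set (sphere (0::complex) 1)) h k"
      by (auto simp: homeomorphism_def homeomorphic_maps_def)
    then have "top_of_set C homeomorphic_space top_of_set (sphere (0::complex) 1)"
      unfolding homeomorphic_space_def by blast
    moreover have "subtopology T (emb -` C) homeomorphic_space subtopology (top_of_set (range emb)) C"
    proof (rule homeomorphic_map_imp_homeomorphic_space)
      show "homeomorphic_map (subtopology T (emb -` C)) (subtopology (top_of_set (range emb)) C) emb"
        using C by (intro homeomorphic_map_subtopologies[OF homeomorphic_map_emb]) auto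
    qed
    moreover have "subtopology (top_of_set (range emb)) C = top_of_set C"
      using C by (simp add: subtopology_subtopology Int_absorb1)
    ultimately have "subtopology T (emb -` C) homeomorphic_space top_of_set (sphere (0::complex) 1)"
      using homeomorphic_space_trans by metis
    then show False using assms(1) unfolding dendrite_def by auto
  qed
  ultimately obtain A B where AB: "openin (top_of_set (range emb)) A" "openin (top_of_set (range emb)) B"
    "A \<inter> B = {}" "A \<union> B = range emb - {emb z}" "emb x \<in> A" "emb y \<in> B"
    using arc_point_separates[OF compact_range_emb locally_quasi_connected_emb, of ?g "emb z"] assms(3-5)
    by (auto simp: path_image_def image_comp[symmetric])
  have "emb ` (emb -` A) = A" "emb ` (emb -` B) = B" using AB(4) by auto
  then have "openin T (emb -` A)" "openin T (emb -` B)" using AB(1,2) openin_emb_image by metis+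
  moreover have "emb -` A \<union> emb -` B = UNIV - {z}" using AB(4) by (auto simp: set_eq_iff)
  moreover have "emb -` A \<inter> emb -` B = {}" "x \<in> emb -` A" "y \<in> emb -` B" using AB(3,5,6) by auto
  ultimately show ?thesis by (intro exI[of _ "emb -` A"] exI[of _ "emb -` B"]) simp
qed

end

section \<open>Energy measures and the intrinsic metric\<close>

context local_resistance_form
begin

text \<open>The integral of \<open>\<phi>\<close> against the energy measure of \<open>f\<close>,
  written without the measure, so that the identities below involve no choice of a representing
  measure.\<close>

definition energy_functional :: "('a \<Rightarrow> real) \<Rightarrow> ('a \<Rightarrow> real) \<Rightarrow> real" where
  "energy_functional f \<phi> = E (\<lambda>x. \<phi> x * f x) f - E \<phi> (\<lambda>x. (f x)\<^sup>2) / 2"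

lemma energy_functional_add:
  assumes "f \<in> F" "\<phi> \<in> F" "\<psi> \<in> F"
  shows "energy_functional f (\<lambda>x. \<phi> x + \<psi> x) = energy_functional f \<phi> + energy_functional f \<psi>"
  using assms by (simp add: energy_functional_def distrib_right E_add F_mult F_square add_divide_distrib)

lemma energy_functional_diff:
  assumes "f \<in> F" "\<phi> \<in> F" "\<psi> \<in> F"
  shows "energy_functional f (\<lambda>x. \<phi> x - \<psi> x) = energy_functional f \<phi> - energy_functional f \<psi>"
  using assms by (simp add: energy_functional_def left_diff_distrib E_diff F_mult F_square diff_divide_distrib)

text \<open>For \<open>c = 1\<close> this is the total mass of the energy measure.\<close>

lemma energy_functional_const: "f \<in> F \<Longrightarrow> energy_functional f (\<lambda>_. c) = c * E f f"
  by (simp add: energy_functional_def E_scale F_square)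

text \<open>The terms \<open>c * E \<phi> f\<close> coming from the product and from the square
  cancel.\<close>

lemma energy_functional_shift:
  assumes "f \<in> F" "\<phi> \<in> F"
  shows "energy_functional (\<lambda>x. f x + c) \<phi> = energy_functional f \<phi>"
proof -
  have "(\<lambda>x. \<phi> x * (f x + c)) = (\<lambda>x. \<phi> x * f x + c * \<phi> x)"
    "(\<lambda>x. (f x + c)\<^sup>2) = (\<lambda>x. (f x)\<^sup>2 + (2 * c) * f x + c\<^sup>2)"
    by (auto simp: algebra_simps power2_sum)
  moreover have "(\<lambda>x. \<phi> x * f x) \<in> F" "(\<lambda>x. (f x)\<^sup>2) \<in> F" "(\<lambda>x. c * \<phi> x) \<in> F" "(\<lambda>x. (2 * c) * f x) \<in> F"
    "(\<lambda>x. (f x)\<^sup>2 + (2 * c) * f x) \<in> F" "(\<lambda>x. \<phi> x * f x + c * \<phi> x) \<in> F"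
    using assms by (auto intro: F_add F_mult F_scale F_square)
  ultimately show ?thesis using assms
    by (simp add: energy_functional_def E_add E_add_right E_scale E_scale_right add_divide_distrib)
qed

lemma energy_functional_minus:
  assumes "f \<in> F" "\<phi> \<in> F"
  shows "energy_functional (\<lambda>x. - f x) \<phi> = energy_functional f \<phi>"
  using assms E_scale[of "\<lambda>x. \<phi> x * f x" "\<lambda>x. - f x" "-1"] E_scale_right[of f "\<lambda>x. \<phi> x * f x" "-1"]
  by (simp add: energy_functional_def F_mult F_minus)

text \<open>With positivity this bounds the energy measure of a difference by twice the sum of the
  two energy measures, which allows approximation in energy.\<close>

lemma energy_functional_parallelogram:
  assumes "f \<in> F" "g \<in> F" "\<phi> \<in> F"
  shows "energy_functional (\<lambda>x. f x + g x) \<phi> + energy_functional (\<lambda>x. f x - g x) \<phi>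
    = 2 * energy_functional f \<phi> + 2 * energy_functional g \<phi>"
proof -
  have F: "(\<lambda>x. \<phi> x * f x) \<in> F" "(\<lambda>x. \<phi> x * g x) \<in> F" "(\<lambda>x. (f x)\<^sup>2) \<in> F" "(\<lambda>x. (g x)\<^sup>2) \<in> F"
    "(\<lambda>x. f x + g x) \<in> F" "(\<lambda>x. f x - g x) \<in> F"
    using assms by (auto intro: F_add F_diff F_mult F_square)
  have sq: "(\<lambda>x. (f x + g x)\<^sup>2) \<in> F" "(\<lambda>x. (f x - g x)\<^sup>2) \<in> F" using F by (auto intro: F_square)
  have "E \<phi> (\<lambda>x. (f x + g x)\<^sup>2) + E \<phi> (\<lambda>x. (f x - g x)\<^sup>2) = E \<phi> (\<lambda>x. (f x + g x)\<^sup>2 + (f x - g x)\<^sup>2)"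
    using sq assms by (simp add: E_add_right)
  also have "(\<lambda>x. (f x + g x)\<^sup>2 + (f x - g x)\<^sup>2) = (\<lambda>x. 2 * ((f x)\<^sup>2 + (g x)\<^sup>2))"
    by (auto simp: power2_sum power2_diff)
  also have "E \<phi> \<dots> = 2 * (E \<phi> (\<lambda>x. (f x)\<^sup>2) + E \<phi> (\<lambda>x. (g x)\<^sup>2))"
    using F assms by (subst E_scale_right) (auto simp: E_add_right intro: F_add)
  finally show ?thesis using F assms
    by (simp add: energy_functional_def distrib_left right_diff_distrib E_add E_add_right E_diff E_diff_right)
qed

text \<open>\<open>f - g\<close> and the difference of the squares vanish on \<open>A\<close>, where
  \<open>\<phi>\<close> lives. \<open>E_cross_eq_0\<close> asks for no distance between the
  functions, so \<open>\<phi>\<close> may be nonzero up to the boundary of \<open>A\<close>, in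
  particular up to \<open>z\<close>.\<close>

lemma energy_functional_local:
  assumes F: "\<phi> \<in> F" "f \<in> F" "g \<in> F" and A: "openin T A" "\<And>x. x \<notin> A \<Longrightarrow> \<phi> x = 0" "\<And>x. x \<in> A \<Longrightarrow> f x = g x"
  shows "energy_functional f \<phi> = energy_functional g \<phi>"
proof -
  have "(\<lambda>x. \<phi> x * f x) = (\<lambda>x. \<phi> x * g x)" using A(2,3) by (auto simp: fun_eq_iff)
  moreover have "E (\<lambda>x. \<phi> x * f x) (\<lambda>x. f x - g x) = 0"
    using F A by (intro E_cross_eq_0[OF _ _ A(1)]) auto
  moreover have "E \<phi> (\<lambda>x. (f x)\<^sup>2 - (g x)\<^sup>2) = 0"
    using F A by (intro E_cross_eq_0[OF _ _ A(1)]) auto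
  ultimately show ?thesis using F
    by (simp add: energy_functional_def E_diff_right F_mult F_square)
qed

end

locale energy_dominated_form = local_resistance_form E F + finite_measure m
  for E :: "('a \<Rightarrow> real) \<Rightarrow> ('a \<Rightarrow> real) \<Rightarrow> real" and F :: "('a \<Rightarrow> real) set" and m :: "'a measure" +
  assumes energy_dominant: "energy_dominant (resistance_topology E F) E F m"
begin

lemma sets_m: "sets m = sets (borel_of_top T)" and space_m [simp]: "space m = UNIV"
  using energy_dominant by (auto simp: energy_dominant_def)

lemma sets_borel_of_T: "openin T U \<Longrightarrow> U \<in> sets (borel_of_top T)"
  by (auto simp: borel_of_top_def sets_measure_of_conv)

lemma F_measurable:
  assumes "u \<in> F" "sets M = sets (borel_of_top T)" "space M = UNIV"
  shows "u \<in> borel_measurable M"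
proof (rule borel_measurableI)
  fix U :: "real set" assume "open U"
  then have "openin T {x \<in> topspace T. u x \<in> U}"
    using openin_continuous_map_preimage[OF F_continuous[OF assms(1)], of U] by simp
  moreover have "{x \<in> topspace T. u x \<in> U} = u -` U \<inter> space M" using assms(3) by auto
  ultimately show "u -` U \<inter> space M \<in> sets M" using sets_borel_of_T assms(2) by metis
qed

lemma F_measurable_m [measurable]: "u \<in> F \<Longrightarrow> u \<in> borel_measurable m"
  using F_measurable sets_m by simp

lemma openin_sets_m: "openin T U \<Longrightarrow> U \<in> sets m"
  using sets_borel_of_T sets_m by simp

text \<open>Positivity is not visible in the formula; it comes from the existence of an energy
  measure, which energy dominance supplies.\<close>

lemma energy_functional_nonneg:
  assumes "f \<in> F" "\<phi> \<in> F" "\<And>x. 0 \<le> \<phi> x"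
  shows "0 \<le> energy_functional f \<phi>"
proof -
  obtain \<mu> where "is_energy_measure T E F f \<mu>" using energy_dominant assms(1) unfolding energy_dominant_def by blast
  then have "energy_functional f \<phi> = integral\<^sup>L \<mu> \<phi>"
    using assms(2) by (simp add: is_energy_measure_def energy_functional_def)
  then show ?thesis using assms(3) by simp
qed

lemma energy_functional_le:
  assumes "f \<in> F" "\<phi> \<in> F" "\<And>x. \<phi> x \<le> 1"
  shows "energy_functional f \<phi> \<le> E f f"
proof -
  have "0 \<le> energy_functional f (\<lambda>x. 1 - \<phi> x)" using assms by (intro energy_functional_nonneg) auto
  then show ?thesis using assms by (simp add: energy_functional_diff energy_functional_const)
qed

text \<open>That points carry no energy, stated through test functions. \<open>h\<close> is
  approximated in energy by some \<open>g\<close> vanishing wherever \<open>h\<close> is small; near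
  \<open>z\<close> only the difference counts, and its total energy is small.\<close>

lemma energy_functional_near_zero:
  assumes h: "h \<in> F" "h z = 0" and "\<eta> > 0"
  shows "\<exists>U. openin T U \<and> z \<in> U \<and> (\<forall>\<phi>\<in>F. (\<forall>x. 0 \<le> \<phi> x \<and> \<phi> x \<le> 1) \<and> (\<forall>x. x \<notin> U \<longrightarrow> \<phi> x = 0)
    \<longrightarrow> energy_functional h \<phi> \<le> \<eta>)"
proof -
  let ?G = "{g \<in> F. \<exists>e>0. \<forall>x. \<bar>h x\<bar> \<le> e \<longrightarrow> g x = 0}"
  have "\<exists>w\<in>?G. (\<forall>x. \<bar>w x - h x\<bar> \<le> e) \<and> E w w \<le> 4 * E h h" if "e > 0" for e
    using trunc[OF h(1) that] that by (intro bexI[of _ "trunc e h"]) auto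
  moreover have "(\<lambda>x. (u x + w x) / 2) \<in> ?G" if uw: "u \<in> ?G" "w \<in> ?G" for u w
  proof -
    obtain a b where "a > 0" "b > 0" "\<And>x. \<bar>h x\<bar> \<le> a \<Longrightarrow> u x = 0" "\<And>x. \<bar>h x\<bar> \<le> b \<Longrightarrow> w x = 0" using uw by blast
    then have "\<exists>e>0. \<forall>x. \<bar>h x\<bar> \<le> e \<longrightarrow> (u x + w x) / 2 = 0" by (intro exI[of _ "min a b"]) auto
    then show ?thesis using uw by auto
  qed
  ultimately have "\<exists>w\<in>?G. E (\<lambda>x. w x - h x) (\<lambda>x. w x - h x) < \<eta> / 2"
    using F_closure(3)[of ?G h "4 * E h h" "\<eta>/2"] \<open>\<eta> > 0\<close> by fastforce
  then obtain g e where g: "g \<in> F" "e > 0" "\<And>x. \<bar>h x\<bar> \<le> e \<Longrightarrow> g x = 0"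
    and gE: "E (\<lambda>x. g x - h x) (\<lambda>x. g x - h x) < \<eta> / 2" by blast
  have "energy_functional h \<phi> \<le> \<eta>"
    if \<phi>: "\<phi> \<in> F" "\<And>x. 0 \<le> \<phi> x" "\<And>x. \<phi> x \<le> 1" "\<And>x. x \<notin> {x. \<bar>h x\<bar> < e / 2} \<Longrightarrow> \<phi> x = 0" for \<phi>
  proof -
    have "(\<lambda>x. \<phi> x * g x) = (\<lambda>_. 0)"
    proof
      fix x show "\<phi> x * g x = 0" using \<phi>(4)[of x] g(2) g(3)[of x] by (cases "\<bar>h x\<bar> < e / 2") auto
    qed
    \<comment> \<open>Half of \<open>e\<close> leaves room: the support of \<open>\<phi>\<close>
      lies in the closed set \<open>\<bar>h x\<bar> \<le> e / 2\<close>, inside the open set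
      \<open>\<bar>h x\<bar> < e\<close> on which \<open>g\<close> vanishes.\<close>
    moreover have "E \<phi> (\<lambda>x. (g x)\<^sup>2) = 0"
    proof (rule E_eq_0_of_supports[where c = 0])
      show "openin T {x. \<bar>h x\<bar> < e}" by (rule F_level_sets(3)[OF h(1)])
      have "fsupport T \<phi> \<subseteq> {x. \<bar>h x\<bar> \<le> e / 2}" by (rule fsupport_subset[OF F_level_sets(2)[OF h(1)]]) (use \<phi>(4) in auto)
      also have "\<dots> \<subseteq> {x. \<bar>h x\<bar> < e}" using g(2) by auto
      finally show "fsupport T \<phi> \<subseteq> {x. \<bar>h x\<bar> < e}" .
    qed (use \<phi> g in auto)
    ultimately have g0: "energy_functional g \<phi> = 0" using g(1) by (simp add: energy_functional_def)
    let ?d = "\<lambda>x. g x - h x"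
    have d: "?d \<in> F" using g h by auto
    \<comment> \<open>Here \<open>h\<close> is \<open>g\<close> minus \<open>?d\<close>, and the
      term of the parallelogram identity for their sum is nonnegative.\<close>
    have "energy_functional h \<phi> \<le> 2 * energy_functional g \<phi> + 2 * energy_functional ?d \<phi>"
      using energy_functional_parallelogram[OF g(1) d \<phi>(1)] energy_functional_nonneg[OF F_add[OF g(1) d] \<phi>(1,2)] by simp
    also have "\<dots> \<le> 2 * E ?d ?d" using g0 energy_functional_le[OF d \<phi>(1,3)] by simp
    finally show ?thesis using gE by simp
  qed
  then show ?thesis using h(2) g(2) F_level_sets(3)[OF h(1), of "e/2"] by (intro exI[of _ "{x. \<bar>h x\<bar> < e / 2}"]) auto
qed

text \<open>Trades the existential over measures for a real density bounded at every point. Only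
  integrals against \<open>F\<close> remain, so densities can be cut and pasted directly.\<close>

lemma Gamma_le_iff:
  "Gamma_le T E F f m \<longleftrightarrow> (\<exists>k\<in>borel_measurable m. (\<forall>x. 0 \<le> k x \<and> k x \<le> 1) \<and>
    (\<forall>\<phi>\<in>F. (LINT x|m. k x * \<phi> x) = energy_functional f \<phi>))"
proof
  assume "Gamma_le T E F f m"
  then obtain \<mu> g where \<mu>: "is_energy_measure T E F f \<mu>" and g: "g \<in> borel_measurable m" "\<mu> = density m g" "AE x in m. g x \<le> 1"
    by (auto simp: Gamma_le_def)
  \<comment> \<open>\<open>g\<close> is extended real and at most 1 almost everywhere; the minimum
    gives the bound everywhere.\<close>
  define k where "k x = min 1 (enn2real (g x))" for x
  have k: "k \<in> borel_measurable m" unfolding k_def using g(1) by measurable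
  have k01: "0 \<le> k x \<and> k x \<le> 1" for x by (simp add: k_def)
  have "AE x in m. g x = ennreal (k x)"
    using g(3)
  proof eventually_elim
    case (elim x)
    then have "enn2real (g x) \<le> 1" "g x < \<top>" using enn2real_mono[of "g x" 1] by (auto simp: le_less_trans)
    then show ?case by (simp add: k_def ennreal_enn2real)
  qed
  then have "\<mu> = density m (\<lambda>x. ennreal (k x))" using g k by (auto intro: density_cong)
  then have "(LINT x|m. k x * \<phi> x) = energy_functional f \<phi>" if "\<phi> \<in> F" for \<phi>
    using \<mu> that k k01 integral_density[of \<phi> m k] by (simp add: is_energy_measure_def energy_functional_def F_measurable_m)
  then show "\<exists>k\<in>borel_measurable m. (\<forall>x. 0 \<le> k x \<and> k x \<le> 1) \<and>
    (\<forall>\<phi>\<in>F. (LINT x|m. k x * \<phi> x) = energy_functional f \<phi>)" using k k01 by blast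
next
  assume "\<exists>k\<in>borel_measurable m. (\<forall>x. 0 \<le> k x \<and> k x \<le> 1) \<and>
    (\<forall>\<phi>\<in>F. (LINT x|m. k x * \<phi> x) = energy_functional f \<phi>)"
  then obtain k where k: "k \<in> borel_measurable m" "\<And>x. 0 \<le> k x" "\<And>x. k x \<le> 1"
    "\<And>\<phi>. \<phi> \<in> F \<Longrightarrow> (LINT x|m. k x * \<phi> x) = energy_functional f \<phi>" by blast
  let ?\<mu> = "density m (\<lambda>x. ennreal (k x))"
  have "finite_measure ?\<mu>"
  proof
    have "emeasure ?\<mu> (space ?\<mu>) = (\<integral>\<^sup>+x. ennreal (k x) \<partial>m)"
      using k(1) emeasure_density[of "\<lambda>x. ennreal (k x)" m UNIV] sets.top[of m] by simp
    also have "\<dots> \<le> (\<integral>\<^sup>+x. 1 \<partial>m)" using k(3) by (intro nn_integral_mono) auto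
    also have "\<dots> < \<infinity>" using emeasure_finite[of "space m"] by (simp add: less_top[symmetric])
    finally show "emeasure ?\<mu> (space ?\<mu>) \<noteq> \<infinity>" by simp
  qed
  moreover have "integral\<^sup>L ?\<mu> \<phi> = energy_functional f \<phi>" if "\<phi> \<in> F" for \<phi>
    using integral_density[OF F_measurable_m[OF that] k(1)] k(2) k(4)[OF that] by simp
  ultimately have "is_energy_measure T E F f ?\<mu>"
    using sets_m by (simp add: is_energy_measure_def energy_functional_def)
  then show "Gamma_le T E F f m" unfolding Gamma_le_def
    using k by (intro exI[of _ ?\<mu>] exI[of _ "\<lambda>x. ennreal (k x)"]) auto
qed

lemma Gamma_le_const: "Gamma_le T E F (\<lambda>_. c) m"
  unfolding Gamma_le_iff by (rule bexI[of _ "\<lambda>_. 0"]) (auto simp: energy_functional_def F_mult)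

lemma Gamma_le_shift:
  assumes "f \<in> F" "Gamma_le T E F f m"
  shows "Gamma_le T E F (\<lambda>x. f x + c) m"
  using assms energy_functional_shift[OF assms(1)] unfolding Gamma_le_iff by simp

lemma Gamma_le_minus:
  assumes "f \<in> F" "Gamma_le T E F f m"
  shows "Gamma_le T E F (\<lambda>x. - f x) m"
  using assms energy_functional_minus[OF assms(1)] unfolding Gamma_le_iff by simp

lemma integrable_weight:
  assumes "k \<in> borel_measurable m" "\<And>x. 0 \<le> k x \<and> k x \<le> 1" "\<phi> \<in> F"
  shows "integrable m (\<lambda>x. k x * \<phi> x)"
proof -
  obtain M where M: "\<And>x. \<bar>\<phi> x\<bar> \<le> M" using F_bounded[OF assms(3)] by blast
  have "\<bar>k x * \<phi> x\<bar> \<le> M" for x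
    using mult_mono[of "\<bar>k x\<bar>" 1 "\<bar>\<phi> x\<bar>" M] assms(2)[of x] M[of x] by (simp add: abs_mult)
  then show ?thesis using assms by (intro integrable_const_bound[where B = M]) auto
qed

lemma E_le_of_Gamma_le:
  assumes "f \<in> F" "Gamma_le T E F f m"
  shows "E f f \<le> measure m UNIV"
proof -
  obtain k where k: "k \<in> borel_measurable m" "\<And>x. 0 \<le> k x \<and> k x \<le> 1"
    "\<And>\<phi>. \<phi> \<in> F \<Longrightarrow> (LINT x|m. k x * \<phi> x) = energy_functional f \<phi>"
    using assms(2) unfolding Gamma_le_iff by blast
  have "E f f = (LINT x|m. k x * 1)" using k(3)[of "\<lambda>_. 1"] assms(1) by (simp add: energy_functional_const)
  also have "\<dots> \<le> (LINT x|m. 1)" using k integrable_weight[OF k(1,2) F_const[of 1]] by (intro integral_mono) auto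
  finally show ?thesis by simp
qed

text \<open>For test functions vanishing at \<open>z\<close> the claim is local on the two sides.
  Any \<open>\<psi>\<close> differs from such a function by the constant \<open>\<psi> z\<close>, so
  what remains is equality of total masses, \<open>(LINT x|m. q x) = E h h\<close>; there the
  absence of energy at \<open>z\<close> enters.\<close>

lemma Gamma_le_glue:
  assumes A: "openin T A" and B: "openin T B" and AB: "A \<inter> B = {}" "A \<union> B = UNIV - {z}"
    and f: "f \<in> F" "f z = 0" "Gamma_le T E F f m"
    and g: "g \<in> F" "g z = 0" "Gamma_le T E F g m"
  defines "h \<equiv> \<lambda>x. if x \<in> A then f x else g x"
  shows "h \<in> F" "Gamma_le T E F h m"
proof -
  have restr: "(\<lambda>x. if x \<in> A then u x else 0) \<in> F" "(\<lambda>x. if x \<in> B then u x else 0) \<in> F" if "u \<in> F" "u z = 0" for u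
    using F_restrict(1)[OF A B AB(1) that(1)] F_restrict(1)[OF B A _ that(1)] AB that by auto
  have "h = (\<lambda>x. (if x \<in> A then f x else 0) + (if x \<in> B then g x else 0))"
    using AB g(2) unfolding h_def by (auto simp: fun_eq_iff set_eq_iff)
  then show hF: "h \<in> F" using F_add[OF restr(1)[OF f(1,2)] restr(2)[OF g(1,2)]] by simp
  have hz: "h z = 0" using f g by (simp add: h_def)
  obtain k where k: "k \<in> borel_measurable m" "\<And>x. 0 \<le> k x \<and> k x \<le> 1"
    "\<And>\<phi>. \<phi> \<in> F \<Longrightarrow> (LINT x|m. k x * \<phi> x) = energy_functional f \<phi>"
    using f(3) unfolding Gamma_le_iff by blast
  obtain l where l: "l \<in> borel_measurable m" "\<And>x. 0 \<le> l x \<and> l x \<le> 1"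
    "\<And>\<phi>. \<phi> \<in> F \<Longrightarrow> (LINT x|m. l x * \<phi> x) = energy_functional g \<phi>"
    using g(3) unfolding Gamma_le_iff by blast
  \<comment> \<open>The value at \<open>z\<close> is 0: \<open>m\<close> may charge
    \<open>z\<close>, the energy of \<open>h\<close> does not.\<close>
  define q where "q x = (if x \<in> A then k x else if x \<in> B then l x else 0)" for x
  have q: "q \<in> borel_measurable m" unfolding q_def
    using k(1) l(1) openin_sets_m[OF A] openin_sets_m[OF B] by (intro measurable_If_set) auto
  have q01: "0 \<le> q x \<and> q x \<le> 1" for x using k(2)[of x] l(2)[of x] by (simp add: q_def)
  have vanish: "(LINT x|m. q x * \<phi> x) = energy_functional h \<phi>" if \<phi>: "\<phi> \<in> F" "\<phi> z = 0" for \<phi>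
  proof -
    let ?a = "\<lambda>x. if x \<in> A then \<phi> x else 0" and ?b = "\<lambda>x. if x \<in> B then \<phi> x else 0"
    have ab: "?a \<in> F" "?b \<in> F" using restr[OF \<phi>] by auto
    have "(\<lambda>x. q x * \<phi> x) = (\<lambda>x. k x * ?a x + l x * ?b x)" using AB by (auto simp: q_def fun_eq_iff)
    then have "(LINT x|m. q x * \<phi> x) = energy_functional f ?a + energy_functional g ?b"
      using integrable_weight[OF k(1,2) ab(1)] integrable_weight[OF l(1,2) ab(2)] k(3)[OF ab(1)] l(3)[OF ab(2)] by simp
    also have "energy_functional f ?a = energy_functional h ?a"
      by (rule energy_functional_local[OF ab(1) f(1) hF A]) (auto simp: h_def)
    also have "energy_functional g ?b = energy_functional h ?b"
      by (rule energy_functional_local[OF ab(2) g(1) hF B]) (use AB in \<open>auto simp: h_def\<close>)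
    also have "energy_functional h ?a + energy_functional h ?b = energy_functional h (\<lambda>x. ?a x + ?b x)"
      using energy_functional_add[OF hF ab] by simp
    also have "(\<lambda>x. ?a x + ?b x) = \<phi>" using AB \<phi>(2) by (auto simp: fun_eq_iff set_eq_iff)
    finally show ?thesis .
  qed
  have "\<exists>\<phi>\<in>F. (\<forall>x. 0 \<le> \<phi> x \<and> \<phi> x \<le> 1) \<and> (\<forall>x. 1 / real (Suc n) \<le> R z x \<longrightarrow> \<phi> x = 0) \<and> \<phi> z = 1" for n
  proof -
    have "openin T (mball z (1 / real (Suc n)))" by (simp add: T_eq)
    then have "closedin T (UNIV - mball z (1 / real (Suc n)))" by (metis closedin_diff closedin_topspace topspace_T)
    moreover have "closedin T {z}" by (simp add: T_eq Hausdorff_space_mtopology closedin_Hausdorff_sing_eq)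
    ultimately obtain \<phi> where "\<phi> \<in> F" "\<forall>x. 0 \<le> \<phi> x \<and> \<phi> x \<le> 1"
      "\<forall>x\<in>UNIV - mball z (1 / real (Suc n)). \<phi> x = 0" "\<phi> z = 1"
      using F_urysohn[of "UNIV - mball z (1 / real (Suc n))" "{z}"] by auto
    then show ?thesis by (intro bexI[of _ \<phi>]) auto
  qed
  then obtain \<phi> where \<phi>: "\<And>n. \<phi> n \<in> F" "\<And>n x. 0 \<le> \<phi> n x \<and> \<phi> n x \<le> 1"
    "\<And>n x. 1 / real (Suc n) \<le> R z x \<Longrightarrow> \<phi> n x = 0" "\<And>n. \<phi> n z = 1" by metis
  have small: "\<forall>\<^sub>F n in sequentially. \<forall>x. r \<le> R z x \<longrightarrow> \<phi> n x = 0" if "r > 0" for r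
  proof -
    have "\<forall>\<^sub>F n in sequentially. inverse (real (Suc n)) < r"
      using order_tendstoD(2)[OF LIMSEQ_inverse_real_of_nat that] .
    then show ?thesis by eventually_elim (auto intro!: \<phi>(3) simp: divide_inverse)
  qed
  \<comment> \<open>The cutoffs converge pointwise to the indicator of \<open>z\<close>, and
    \<open>q\<close> vanishes at \<open>z\<close>.\<close>
  have lim1: "(\<lambda>n. LINT x|m. q x * \<phi> n x) \<longlonglongrightarrow> (LINT x|m. 0)"
  proof (rule integral_dominated_convergence[where w = "\<lambda>_. 1"])
    show "AE x in m. (\<lambda>n. q x * \<phi> n x) \<longlonglongrightarrow> 0"
    proof (rule AE_I2)
      fix x
      show "(\<lambda>n. q x * \<phi> n x) \<longlonglongrightarrow> 0"
      proof (cases "x = z")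
        case True then show ?thesis using AB by (auto simp: q_def)
      next
        case False
        then have "R z x > 0" using zero[of z x] nonneg[of z x] by (simp add: less_le)
        from small[OF this] have "\<forall>\<^sub>F n in sequentially. q x * \<phi> n x = 0" by eventually_elim auto
        then show ?thesis by (rule tendsto_eventually)
      qed
    qed
    show "AE x in m. norm (q x * \<phi> n x) \<le> 1" for n
      using q01 \<phi>(2) by (intro AE_I2) (auto simp: abs_mult intro: mult_le_one)
  qed (use q \<phi>(1) in auto)
  have lim2: "(\<lambda>n. energy_functional h (\<phi> n)) \<longlonglongrightarrow> 0"
  proof (rule order_tendstoI)
    fix a :: real assume "a < 0"
    then show "\<forall>\<^sub>F n in sequentially. a < energy_functional h (\<phi> n)"
      using energy_functional_nonneg[OF hF \<phi>(1)] \<phi>(2) by (intro always_eventually) (auto intro: less_le_trans)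
  next
    fix a :: real assume "a > 0"
    then obtain U where U: "openin T U" "z \<in> U" "\<And>\<phi>. \<phi> \<in> F \<Longrightarrow> (\<forall>x. 0 \<le> \<phi> x \<and> \<phi> x \<le> 1) \<Longrightarrow> (\<forall>x. x \<notin> U \<longrightarrow> \<phi> x = 0)
      \<Longrightarrow> energy_functional h \<phi> \<le> a / 2" using energy_functional_near_zero[OF hF hz, of "a/2"] by (auto 0 3)
    obtain r where r: "r > 0" "\<And>y. R z y < r \<Longrightarrow> y \<in> U" using U(1,2) unfolding openin_T_iff by blast
    from small[OF r(1)] show "\<forall>\<^sub>F n in sequentially. energy_functional h (\<phi> n) < a"
    proof eventually_elim
      case (elim n)
      then have "energy_functional h (\<phi> n) \<le> a / 2" using r(2) \<phi> by (intro U(3)) (auto simp: not_less[symmetric])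
      then show ?case using \<open>a > 0\<close> by simp
    qed
  qed
  have one: "(LINT x|m. q x) = E h h"
  proof -
    \<comment> \<open>\<open>1 - \<phi> n\<close> vanishes at \<open>z\<close>, so the defect of
      total mass equals the defect on \<open>\<phi> n\<close> for every \<open>n\<close>, and both
      terms of the latter tend to 0.\<close>
    have "(LINT x|m. q x) - E h h = (LINT x|m. q x * \<phi> n x) - energy_functional h (\<phi> n)" for n
    proof -
      have "(LINT x|m. q x * (1 - \<phi> n x)) = energy_functional h (\<lambda>x. 1 - \<phi> n x)"
        using \<phi> by (intro vanish) auto
      moreover have "(LINT x|m. q x * (1 - \<phi> n x)) = (LINT x|m. q x) - (LINT x|m. q x * \<phi> n x)"
        using integrable_weight[OF q q01 \<phi>(1)[of n]] integrable_weight[OF q q01 F_const[of 1]] by (simp add: right_diff_distrib)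
      ultimately show ?thesis using \<phi>(1) hF by (simp add: energy_functional_diff energy_functional_const)
    qed
    then have "(\<lambda>n. (LINT x|m. q x * \<phi> n x) - energy_functional h (\<phi> n)) = (\<lambda>_. (LINT x|m. q x) - E h h)" by auto
    moreover have "(\<lambda>n. (LINT x|m. q x * \<phi> n x) - energy_functional h (\<phi> n)) \<longlonglongrightarrow> 0"
      using tendsto_diff[OF lim1 lim2] by simp
    ultimately show ?thesis by (simp add: LIMSEQ_const_iff)
  qed
  have "(LINT x|m. q x * \<psi> x) = energy_functional h \<psi>" if \<psi>: "\<psi> \<in> F" for \<psi>
  proof -
    have "(LINT x|m. q x * (\<psi> x - \<psi> z)) = energy_functional h (\<lambda>x. \<psi> x - \<psi> z)" using \<psi> by (intro vanish) auto
    moreover have "(LINT x|m. q x * (\<psi> x - \<psi> z)) = (LINT x|m. q x * \<psi> x) - \<psi> z * (LINT x|m. q x)"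
      using integrable_weight[OF q q01 \<psi>] integrable_weight[OF q q01 F_const[of 1]] by (simp add: right_diff_distrib mult.commute)
    ultimately show ?thesis using \<psi> hF one by (simp add: energy_functional_diff energy_functional_const)
  qed
  then show "Gamma_le T E F h m" unfolding Gamma_le_iff using q q01 by blast
qed

section \<open>The intrinsic metric\<close>

lemma bdd_above_Gamma: "bdd_above {f x - f y | f. f \<in> F \<and> Gamma_le T E F f m}"
proof (rule bdd_aboveI)
  fix t assume "t \<in> {f x - f y | f. f \<in> F \<and> Gamma_le T E F f m}"
  then obtain f where f: "f \<in> F" "Gamma_le T E F f m" "t = f x - f y" by blast
  have "t\<^sup>2 \<le> E f f * R x y" using oscillation_le[OF f(1)] f(3) by simp
  also have "\<dots> \<le> measure m UNIV * R x y" using E_le_of_Gamma_le[OF f(1,2)] by (intro mult_right_mono) auto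
  finally show "t \<le> sqrt (measure m UNIV * R x y)" by (rule real_le_rsqrt)
qed

lemma d_Gamma_upper:
  "f \<in> F \<Longrightarrow> Gamma_le T E F f m \<Longrightarrow> f x - f y \<le> d_Gamma T E F m x y"
  unfolding d_Gamma_def by (rule cSup_upper[OF _ bdd_above_Gamma]) blast

lemma d_Gamma_least:
  assumes "\<And>f. f \<in> F \<Longrightarrow> Gamma_le T E F f m \<Longrightarrow> f x - f y \<le> c"
  shows "d_Gamma T E F m x y \<le> c"
  unfolding d_Gamma_def
proof (rule cSup_least)
  show "{f x - f y | f. f \<in> F \<and> Gamma_le T E F f m} \<noteq> {}" using Gamma_le_const[of 0] F_const[of 0] by blast
qed (use assms in blast)

lemma d_Gamma_self: "d_Gamma T E F m x x = 0"
proof (rule antisym)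
  show "0 \<le> d_Gamma T E F m x x" using d_Gamma_upper[OF F_const Gamma_le_const, of 0 x x] by simp
qed (rule d_Gamma_least, simp)

lemma d_Gamma_commute_le: "d_Gamma T E F m x y \<le> d_Gamma T E F m y x"
proof (rule d_Gamma_least)
  fix f assume "f \<in> F" "Gamma_le T E F f m"
  then show "f x - f y \<le> d_Gamma T E F m y x"
    using d_Gamma_upper[OF F_minus Gamma_le_minus, of f y x] by simp
qed

lemma d_Gamma_triangle: "d_Gamma T E F m x z \<le> d_Gamma T E F m x y + d_Gamma T E F m y z"
proof (rule d_Gamma_least)
  fix f assume "f \<in> F" "Gamma_le T E F f m"
  then show "f x - f z \<le> d_Gamma T E F m x y + d_Gamma T E F m y z"
    using d_Gamma_upper[of f x y] d_Gamma_upper[of f y z] by simp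
qed

text \<open>The oscillation estimate turns approximation in energy into approximation of
  \<open>u x - u y\<close>. If all coordinates agreed at \<open>x\<close> and \<open>y\<close>, so
  would every function in \<open>F\<close>.\<close>

lemma d_Gamma_pos:
  assumes "coordinate_sequence T E F m fs" "x \<noteq> y"
  shows "0 < d_Gamma T E F m x y"
proof -
  have fs: "fs n \<in> F" "Gamma_le T E F (fs n) m" for n using assms(1) by (auto simp: coordinate_sequence_def)
  have dense: "\<exists>N c. E (\<lambda>x. u x - (\<Sum>i<N. c i * fs i x)) (\<lambda>x. u x - (\<Sum>i<N. c i * fs i x)) < e" if ue: "u \<in> F" "e > 0" for u e
  proof -
    obtain N c where "E (\<lambda>x. u x - (\<Sum>i<N. c i * fs i x)) (\<lambda>x. u x - (\<Sum>i<N. c i * fs i x))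
      + (LINT x|m. (u x - (\<Sum>i<N. c i * fs i x))\<^sup>2) < e"
      using assms(1)[unfolded coordinate_sequence_def Let_def, THEN conjunct2, THEN bspec, OF ue(1), THEN spec, THEN mp, OF ue(2)]
      by (elim exE)
    moreover have "0 \<le> (LINT x|m. (u x - (\<Sum>i<N. c i * fs i x))\<^sup>2)" by (rule Bochner_Integration.integral_nonneg) simp
    ultimately have "E (\<lambda>x. u x - (\<Sum>i<N. c i * fs i x)) (\<lambda>x. u x - (\<Sum>i<N. c i * fs i x)) < e" by linarith
    then show ?thesis by blast
  qed
  have "\<exists>n. fs n x \<noteq> fs n y"
  proof (rule ccontr)
    assume "\<not> (\<exists>n. fs n x \<noteq> fs n y)"
    then have same: "fs n x = fs n y" for n by blast
    obtain u where u: "u \<in> F" "u x \<noteq> u y" using separates[OF assms(2)] by blast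
    have Rpos: "R x y > 0" using assms(2) zero[of x y] nonneg[of x y] by (simp add: less_le)
    \<comment> \<open>By \<open>same\<close> the approximation error has increment
      \<open>u x - u y\<close>, hence energy at least \<open>(u x - u y)^2 / R x y\<close>, which
      this tolerance excludes.\<close>
    obtain N c where c: "E (\<lambda>x. u x - (\<Sum>i<N. c i * fs i x)) (\<lambda>x. u x - (\<Sum>i<N. c i * fs i x)) < (u x - u y)\<^sup>2 / R x y"
      using dense[OF u(1), of "(u x - u y)\<^sup>2 / R x y"] u(2) Rpos by auto
    let ?v = "\<lambda>x. u x - (\<Sum>i<N. c i * fs i x)"
    have "?v \<in> F" using u(1) fs(1) by (intro F_diff F_sum F_scale)
    from oscillation_le[OF this, of x y] have "(u x - u y)\<^sup>2 \<le> E ?v ?v * R x y" using same by simp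
    also have "\<dots> < (u x - u y)\<^sup>2" using c Rpos by (simp add: field_simps)
    finally show False by simp
  qed
  then obtain n where n: "fs n x \<noteq> fs n y" by blast
  \<comment> \<open>\<open>- fs n\<close> is admissible too, so the sign of the difference does not
    matter.\<close>
  show ?thesis
    using d_Gamma_upper[OF fs, of n x y] d_Gamma_upper[OF F_minus Gamma_le_minus, OF fs(1) fs, of n x y] n by linarith
qed

lemma d_Gamma_metric:
  assumes "coordinate_sequence T E F m fs"
  shows "Metric_space UNIV (d_Gamma T E F m)"
proof
  fix x y z
  show comm: "d_Gamma T E F m x y = d_Gamma T E F m y x" for x y using d_Gamma_commute_le[of x y] d_Gamma_commute_le[of y x] by simp
  show "0 \<le> d_Gamma T E F m x y" using d_Gamma_triangle[of x x y] comm d_Gamma_self[of x] by simp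
  show "d_Gamma T E F m x y = 0 \<longleftrightarrow> x = y" using d_Gamma_pos[OF assms, of x y] d_Gamma_self by force
qed (rule d_Gamma_triangle)

lemma d_Gamma_arc_additive:
  assumes "dendrite T" "z \<in> arc_image T x y"
  shows "d_Gamma T E F m x y = d_Gamma T E F m x z + d_Gamma T E F m z y"
proof (cases "z = x \<or> z = y")
  case True then show ?thesis by (auto simp: d_Gamma_self)
next
  case False
  then obtain g where "arc_in T g x y" "z \<in> g ` {0..1}" using assms(2) by (auto simp: arc_image_def split: if_splits)
  from dendrite_arc_point_separates[OF assms(1) this] False obtain A B where
    A: "openin T A" and B: "openin T B" and AB: "A \<inter> B = {}" "A \<union> B = UNIV - {z}" and xy: "x \<in> A" "y \<in> B" by blast
  \<comment> \<open>Shifts preserve increments and energy measures; since \<open>x\<close> lies in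
    \<open>A\<close> and \<open>y\<close> does not, \<open>?h x - ?h y\<close> is the sum on the
    left.\<close>
  have glue: "(f x - f z) + (g z - g y) \<le> d_Gamma T E F m x y"
    if f: "f \<in> F" "Gamma_le T E F f m" and g: "g \<in> F" "Gamma_le T E F g m" for f g
  proof -
    let ?f = "\<lambda>t. f t + - f z" and ?g = "\<lambda>t. g t + - g z"
    let ?h = "\<lambda>t. if t \<in> A then ?f t else ?g t"
    have fF: "?f \<in> F" and gF: "?g \<in> F" using f g by (auto intro: F_add)
    have fz: "?f z = 0" and gz: "?g z = 0" by auto
    have "y \<notin> A" using xy(2) AB(1) by blast
    note glued = Gamma_le_glue[OF A B AB fF fz Gamma_le_shift[OF f] gF gz Gamma_le_shift[OF g]]
    from d_Gamma_upper[OF glued, of x y] xy(1) \<open>y \<notin> A\<close> show ?thesis by simp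
  qed
  \<comment> \<open>The two suprema are taken in turn: over \<open>f\<close> for fixed
    \<open>g\<close>, then over \<open>g\<close>.\<close>
  have "d_Gamma T E F m x z \<le> d_Gamma T E F m x y - (g z - g y)" if "g \<in> F" "Gamma_le T E F g m" for g
    using glue[OF _ _ that] by (intro d_Gamma_least) (simp add: le_diff_eq)
  then have "d_Gamma T E F m z y \<le> d_Gamma T E F m x y - d_Gamma T E F m x z"
    by (intro d_Gamma_least) (simp add: le_diff_eq add.commute)
  then show ?thesis using d_Gamma_triangle[of x y z] by linarith
qed

end

text \<open>\<open>Sup\<close> of an unbounded set of reals is unspecified; the first conjunct
  certifies that \<open>d_Gamma\<close> is a genuine supremum.\<close>

theorem theorem3p4:
  fixes E :: "('a \<Rightarrow> real) \<Rightarrow> ('a \<Rightarrow> real) \<Rightarrow> real"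
    and F :: "('a \<Rightarrow> real) set"
    and m :: "'a measure"
  assumes "resistance_form E F"
    and "dendrite (resistance_topology E F)"
    and "strongly_local (resistance_topology E F) E F"
    and "compact_space (resistance_topology E F)"
    and "finite_measure m"
    and "energy_dominant (resistance_topology E F) E F m"
    and "\<exists>fs. coordinate_sequence (resistance_topology E F) E F m fs"
  shows "(\<forall>x y. bdd_above {f x - f y | f. f \<in> F \<and> Gamma_le (resistance_topology E F) E F f m})
    \<and> shortest_path_metric (resistance_topology E F) (d_Gamma (resistance_topology E F) E F m)"
proof -
  interpret finite_measure m by (rule assms(5))
  interpret energy_dominated_form E F m by unfold_locales (use assms in auto)
  obtain fs where "coordinate_sequence (resistance_topology E F) E F m fs" using assms(7) by blast
  then show ?thesis
    using bdd_above_Gamma d_Gamma_metric d_Gamma_arc_additive[OF assms(2)]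
    by (simp add: shortest_path_metric_def)
qed

end
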